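(* Let $\alpha,\beta,\gamma\in[0,\infty)$, let $t_0\in I$, and let $u\in C(I,H^1(\mathbb{R}^2))$ be a weak solution of the hyperelastic compressible plate model $$\bigl(u_t-u_{xxt}+3uu_x-\gamma(2u_xu_{xx}+uu_{xxx})\bigr)_x-\alpha u_{yy}+\beta u_{xxyy}=0$$ with initial data $u_0(x,y)=u(t_0,x,y)$ such that the model is locally well-posed (in particular, $u$ is the only weak solution on $I$ with value $u_0$ at time $t_0$). If $u$ is $x$-symmetric, then $u$ is a traveling wave in the $x$-direction.
   Context: $I=[0,T]$ with $T>0$, and $Lf:=\partial_x(1-\partial_x^2)f$. All functions are real-valued, and identities between $H^1(\mathbb{R}^2)$-valued functions are understood for every $t\in I$ and almost every $(x,y)\in\mathbb{R}^2$. Weak solution: a function $u\in C(I,H^1(\mathbb{R}^2))$ is a weak solution of the model if $$\iiint_{I\times\mathbb{R}^2}\Bigl[u\,L(\partial_t\phi)+\bigl(\tfrac32u^2+\tfrac{\gamma}{2}(\partial_xu)^2\bigr)\partial_x^2\phi-\tfrac{\gamma}{2}u^2\,\partial_x^4\phi-\alpha u\,\partial_y^2\phi+\beta u\,\partial_x^2\partial_y^2\phi\Bigr]\,\mathrm{d}t\,\mathrm{d}x\,\mathrm{d}y=0$$ for all $\phi\in C_0^\infty(I\times\mathbb{R}^2)$. Here $C_0^\infty(I\times\mathbb{R}^2)$ denotes smooth functions with compact support in $(0,T)\times\mathbb{R}^2$ (so test functions vanish near the endpoints of $I$). $x$-symmetric: there exists $\lambda\in C^1(\mathbb{R})$ such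 that $u(t,x,y)=u(t,2\lambda(t)-x,y)$ on $I\times\mathbb{R}^2$. Traveling wave in the $x$-direction (equivalently, steady in the $x$-direction): there exist a constant $c\in\mathbb{R}$ and a function $g$ such that $u(t,x,y)=g(x-ct,y)$ on $I\times\mathbb{R}^2$. *)

theory Defs
  imports "HOL-Analysis.Analysis"
begin

definition dir_deriv :: "'a::real_normed_vector \<Rightarrow> ('a \<Rightarrow> real) \<Rightarrow> 'a \<Rightarrow> real" where
  "dir_deriv v f = (\<lambda>p. frechet_derivative f (at p) v)"

primrec cont_diff :: "nat \<Rightarrow> ('a::real_normed_vector \<Rightarrow> real) \<Rightarrow> bool" where
  "cont_diff 0 f \<longleftrightarrow> continuous_on UNIV f"
| "cont_diff (Suc n) f \<longleftrightarrow> (\<forall>p. f differentiable (at p)) \<and> (\<forall>v. cont_diff n (dir_deriv v f))"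

definition test_function :: "'a::real_normed_vector set \<Rightarrow> ('a \<Rightarrow> real) \<Rightarrow> bool" where
  "test_function U \<phi> \<longleftrightarrow>
     (\<forall>n. cont_diff n \<phi>) \<and> compact (closure {p. \<phi> p \<noteq> 0}) \<and> closure {p. \<phi> p \<noteq> 0} \<subseteq> U"

(* Elements of L^2 and H^1 are represented by functions on the plane; equality of elements
   is equality almost everywhere. *)

definition L2 :: "(real \<times> real \<Rightarrow> real) \<Rightarrow> bool" where
  "L2 f \<longleftrightarrow> f \<in> borel_measurable lebesgue \<and> integrable lebesgue (\<lambda>p. (f p)\<^sup>2)"

definition is_weak_deriv ::
  "real \<times> real \<Rightarrow> (real \<times> real \<Rightarrow> real) \<Rightarrow> (real \<times> real \<Rightarrow> real) \<Rightarrow> bool" where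
  "is_weak_deriv v f g \<longleftrightarrow>
     (\<forall>\<psi>. test_function UNIV \<psi> \<longrightarrow>
        (LINT p|lebesgue. f p * dir_deriv v \<psi> p) = - (LINT p|lebesgue. g p * \<psi> p))"

definition H1 :: "(real \<times> real \<Rightarrow> real) \<Rightarrow> bool" where
  "H1 f \<longleftrightarrow> L2 f \<and> (\<exists>g. L2 g \<and> is_weak_deriv (1, 0) f g) \<and> (\<exists>g. L2 g \<and> is_weak_deriv (0, 1) f g)"

(* The weak derivative of a function in H^1; it is unique only up to null sets, so the choice
   picks a representative. *)
definition weak_deriv :: "real \<times> real \<Rightarrow> (real \<times> real \<Rightarrow> real) \<Rightarrow> real \<times> real \<Rightarrow> real" where
  "weak_deriv v f = (SOME g. L2 g \<and> is_weak_deriv v f g)"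

definition H1_norm :: "(real \<times> real \<Rightarrow> real) \<Rightarrow> real" where
  "H1_norm f = sqrt ((LINT p|lebesgue. (f p)\<^sup>2)
     + (LINT p|lebesgue. (weak_deriv (1, 0) f p)\<^sup>2)
     + (LINT p|lebesgue. (weak_deriv (0, 1) f p)\<^sup>2))"

definition continuous_H1 :: "real set \<Rightarrow> (real \<Rightarrow> real \<times> real \<Rightarrow> real) \<Rightarrow> bool" where
  "continuous_H1 I u \<longleftrightarrow>
     (\<forall>t\<in>I. H1 (u t)) \<and>
     (\<forall>t\<in>I. ((\<lambda>s. H1_norm (\<lambda>p. u s p - u t p)) \<longlongrightarrow> 0) (at t within I))"

(* Points of space-time are triples (t, x, y). *)

abbreviation Dt :: "(real \<times> real \<times> real \<Rightarrow> real) \<Rightarrow> real \<times> real \<times> real \<Rightarrow> real" where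
  "Dt \<equiv> dir_deriv (1, 0, 0)"

abbreviation Dx :: "(real \<times> real \<times> real \<Rightarrow> real) \<Rightarrow> real \<times> real \<times> real \<Rightarrow> real" where
  "Dx \<equiv> dir_deriv (0, 1, 0)"

abbreviation Dy :: "(real \<times> real \<times> real \<Rightarrow> real) \<Rightarrow> real \<times> real \<times> real \<Rightarrow> real" where
  "Dy \<equiv> dir_deriv (0, 0, 1)"

definition L_op :: "(real \<times> real \<times> real \<Rightarrow> real) \<Rightarrow> real \<times> real \<times> real \<Rightarrow> real" where
  "L_op f = Dx (\<lambda>p. f p - Dx (Dx f) p)"

(* The integral over I \<times> R^2 is taken as an iterated integral: for u in C(I, H^1) the inner
   integral is continuous in t and does not depend on the representatives of the u t, whereas
   an arbitrary choice of representatives need not be jointly measurable in (t, x, y). *)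
definition weak_solution ::
  "real \<Rightarrow> real \<Rightarrow> real \<Rightarrow> real \<Rightarrow> (real \<Rightarrow> real \<times> real \<Rightarrow> real) \<Rightarrow> bool" where
  "weak_solution \<alpha> \<beta> \<gamma> T u \<longleftrightarrow>
     continuous_H1 {0..T} u \<and>
     (\<forall>\<phi>. test_function ({0<..<T} \<times> UNIV) \<phi> \<longrightarrow>
        (LINT t:{0..T}|lebesgue. (LINT p|lebesgue.
             u t p * L_op (Dt \<phi>) (t, p)
           + (3 / 2 * (u t p)\<^sup>2 + \<gamma> / 2 * (weak_deriv (1, 0) (u t) p)\<^sup>2) * Dx (Dx \<phi>) (t, p)
           - \<gamma> / 2 * (u t p)\<^sup>2 * Dx (Dx (Dx (Dx \<phi>))) (t, p)
           - \<alpha> * u t p * Dy (Dy \<phi>) (t, p)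
           + \<beta> * u t p * Dx (Dx (Dy (Dy \<phi>))) (t, p))) = 0)"

definition x_symmetric :: "real set \<Rightarrow> (real \<Rightarrow> real \<times> real \<Rightarrow> real) \<Rightarrow> bool" where
  "x_symmetric I u \<longleftrightarrow>
     (\<exists>l::real \<Rightarrow> real. l C1_differentiable_on UNIV \<and>
        (\<forall>t\<in>I. AE (x, y) in lebesgue. u t (x, y) = u t (2 * l t - x, y)))"

definition x_traveling_wave :: "real set \<Rightarrow> (real \<Rightarrow> real \<times> real \<Rightarrow> real) \<Rightarrow> bool" where
  "x_traveling_wave I u \<longleftrightarrow>
     (\<exists>(c::real) (g::real \<times> real \<Rightarrow> real).
        \<forall>t\<in>I. AE (x, y) in lebesgue. u t (x, y) = g (x - c * t, y))"

(* Uniqueness is the only consequence of local well-posedness that is assumed; existence for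
   the datum u t0 is witnessed by u itself. *)
definition only_weak_solution ::
  "real \<Rightarrow> real \<Rightarrow> real \<Rightarrow> real \<Rightarrow> real \<Rightarrow> (real \<Rightarrow> real \<times> real \<Rightarrow> real) \<Rightarrow> bool" where
  "only_weak_solution \<alpha> \<beta> \<gamma> T t0 u \<longleftrightarrow>
     (\<forall>v. weak_solution \<alpha> \<beta> \<gamma> T v \<and> (AE p in lebesgue. v t0 p = u t0 p)
        \<longrightarrow> (\<forall>t\<in>{0..T}. AE p in lebesgue. v t p = u t p))"

end

theory Submission
  imports Defs
begin

text \<open>
  Fix a time and pair the solution with a test function of space alone. The weak formulation,
  tested with products of a function of time and a function of space, says that the pairing
  \<open>mass_form (u t) \<psi>\<close> of \<open>u t\<close> with \<open>L \<psi>\<close> is differentiable in t and that its derivative is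
  \<open>flux_form (u t) \<psi>\<close>, the sum of all remaining terms (\<open>mass_form_has_derivative\<close>).

  The operator L is odd in x while the flux terms are even in x. If \<open>u t\<close> is symmetric about
  \<open>x = l t\<close>, then reflecting \<open>\<psi>\<close> at this axis changes the sign of the first pairing and leaves the
  second one alone. Differentiating the resulting identity in time, including the motion
  of the axis, leaves
  \<open>flux_form (u t) \<psi> = l' t * mass_form (u t) (dx \<psi>)\<close> for every time t
  (\<open>symmetric_flux_form\<close>). At the time \<open>t0\<close> this is exactly the weak equation for the profile of a
  wave with speed \<open>c = l' t0\<close>. Hence \<open>u t0\<close>, moved along with speed c, is a weak solution
  (\<open>weak_solution_traveling\<close>); it agrees with u at \<open>t0\<close>, and by uniqueness everywhere.

  Three facts from analysis carry the passage from this outline to functions that have only weak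
  derivatives in mean square. Weak derivatives are unique almost everywhere
  (\<open>fundamental_lemma_L2\<close>), so they can be computed for reflected and translated functions.
  Translations are continuous in mean square (\<open>translation_L2_continuous\<close>), so the moving profile
  is a continuous curve in the Sobolev space and the pairings depend continuously on the axis.
  Finally, a continuous function whose weak derivative in time is continuous is differentiable
  (\<open>du_Bois_Reymond\<close>).
\<close>

section \<open>Smooth functions and test functions\<close>

text \<open>
  The class of all \<^const>\<open>cont_diff\<close> levels at once, so that derivatives can be taken without
  counting how many are left.
\<close>
definition smooth :: "('a::real_normed_vector \<Rightarrow> real) \<Rightarrow> bool" where
  "smooth f \<longleftrightarrow> (\<forall>n. cont_diff n f)"

lemma dir_deriv_eq: "(f has_derivative D) (at p) \<Longrightarrow> dir_deriv v f p = D v"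
  by (simp add: dir_deriv_def frechet_derivative_at[symmetric])

lemma has_derivative_dir_deriv:
  "f differentiable (at p) \<Longrightarrow> (f has_derivative (\<lambda>v. dir_deriv v f p)) (at p)"
  by (simp add: dir_deriv_def frechet_derivative_works)

lemma cont_diff_Suc_D: "cont_diff (Suc n) f \<Longrightarrow> cont_diff n f"
proof (induction n arbitrary: f)
  case 0
  then show ?case
    by (auto simp: continuous_on_eq_continuous_within intro: differentiable_imp_continuous_within)
qed (metis cont_diff.simps(2))

lemma cont_diff_const [intro, simp]: "cont_diff n (\<lambda>x. c)"
proof (induction n arbitrary: c)
  case (Suc n)
  have "dir_deriv v (\<lambda>x::'a. c) = (\<lambda>x. 0)" for v :: 'a
    by (rule ext) (rule dir_deriv_eq[where D="\<lambda>_. 0", simplified], simp)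
  with Suc show ?case by simp
qed simp

lemma dir_deriv_add:
  assumes "f differentiable (at p)" "g differentiable (at p)"
  shows "dir_deriv v (\<lambda>x. f x + g x) p = dir_deriv v f p + dir_deriv v g p"
  by (rule dir_deriv_eq) (intro has_derivative_add has_derivative_dir_deriv assms)

lemma dir_deriv_mult:
  assumes "f differentiable (at p)" "g differentiable (at p)"
  shows "dir_deriv v (\<lambda>x. f x * g x) p = f p * dir_deriv v g p + dir_deriv v f p * g p"
  by (rule dir_deriv_eq[where D="\<lambda>v. f p * dir_deriv v g p + dir_deriv v f p * g p"])
     (intro has_derivative_mult has_derivative_dir_deriv assms)

lemma dir_deriv_cmult:
  assumes "f differentiable (at p)"
  shows "dir_deriv v (\<lambda>x. c * f x) p = c * dir_deriv v f p"
  by (rule dir_deriv_eq) (intro has_derivative_mult_right has_derivative_dir_deriv assms)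

lemma dir_deriv_diff:
  assumes "f differentiable (at p)" "g differentiable (at p)"
  shows "dir_deriv v (\<lambda>x. f x - g x) p = dir_deriv v f p - dir_deriv v g p"
  by (rule dir_deriv_eq) (intro has_derivative_diff has_derivative_dir_deriv assms)

lemma cont_diff_add [intro]: "cont_diff n f \<Longrightarrow> cont_diff n g \<Longrightarrow> cont_diff n (\<lambda>x. f x + g x)"
proof (induction n arbitrary: f g)
  case (Suc n)
  then have "dir_deriv v (\<lambda>x. f x + g x) = (\<lambda>x. dir_deriv v f x + dir_deriv v g x)" for v
    by (auto intro!: ext dir_deriv_add)
  with Suc show ?case by (auto intro!: differentiable_add)
qed (auto intro: continuous_intros)

lemma cont_diff_mult [intro]: "cont_diff n f \<Longrightarrow> cont_diff n g \<Longrightarrow> cont_diff n (\<lambda>x. f x * g x)"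
proof (induction n arbitrary: f g)
  case (Suc n)
  then have "dir_deriv v (\<lambda>x. f x * g x) = (\<lambda>x. f x * dir_deriv v g x + dir_deriv v f x * g x)" for v
    by (auto intro!: ext dir_deriv_mult)
  with Suc cont_diff_Suc_D[OF Suc.prems(1)] cont_diff_Suc_D[OF Suc.prems(2)]
  show ?case by (auto intro!: differentiable_mult cont_diff_add)
qed (auto intro: continuous_intros)

lemma has_derivative_affine:
  "bounded_linear A \<Longrightarrow> ((\<lambda>x. A x + b) has_derivative A) (at x)"
  using has_derivative_add[OF bounded_linear_imp_has_derivative has_derivative_const] by simp

lemma dir_deriv_affine:
  assumes "bounded_linear A" "f differentiable (at (A x + b))"
  shows "dir_deriv v (\<lambda>x. f (A x + b)) x = dir_deriv (A v) f (A x + b)"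
  by (rule dir_deriv_eq[where D="\<lambda>v. dir_deriv (A v) f (A x + b)"],
      rule has_derivative_compose[OF has_derivative_affine[OF assms(1)] has_derivative_dir_deriv[OF assms(2)]])

lemma cont_diff_affine:
  assumes "bounded_linear A" "cont_diff n f"
  shows "cont_diff n (\<lambda>x. f (A x + b))"
  using assms(2)
proof (induction n arbitrary: f)
  case 0
  then show ?case
    by (auto intro!: continuous_on_compose2[of UNIV f] continuous_intros
        bounded_linear.continuous_on[OF assms(1)])
next
  case (Suc n)
  then have "dir_deriv v (\<lambda>x. f (A x + b)) = (\<lambda>x. dir_deriv (A v) f (A x + b))" for v
    by (auto intro!: ext dir_deriv_affine assms)
  moreover have "(\<lambda>x. f (A x + b)) differentiable (at p)" for p
  proof -
    have "f differentiable (at (A p + b))" using Suc.prems by simp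
    from has_derivative_compose[OF has_derivative_affine[OF assms(1)] has_derivative_dir_deriv[OF this]]
    show ?thesis by (auto simp: differentiable_def)
  qed
  ultimately show ?case using Suc by simp
qed

lemma smooth_const [simp]: "smooth (\<lambda>x. c)" by (simp add: smooth_def)
lemma smooth_add: "smooth f \<Longrightarrow> smooth g \<Longrightarrow> smooth (\<lambda>x. f x + g x)" by (auto simp: smooth_def)
lemma smooth_mult: "smooth f \<Longrightarrow> smooth g \<Longrightarrow> smooth (\<lambda>x. f x * g x)" by (auto simp: smooth_def)
lemma smooth_cmult: "smooth f \<Longrightarrow> smooth (\<lambda>x. c * f x)" by (simp add: smooth_mult)
lemma smooth_diff: "smooth f \<Longrightarrow> smooth g \<Longrightarrow> smooth (\<lambda>x. f x - g x)"
  using smooth_add[of f "\<lambda>x. -1 * g x"] smooth_cmult[of g "-1"] by simp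
lemma smooth_affine: "smooth f \<Longrightarrow> bounded_linear A \<Longrightarrow> smooth (\<lambda>x. f (A x + b))"
  by (auto simp: smooth_def intro: cont_diff_affine)
lemma smooth_dir_deriv: "smooth f \<Longrightarrow> smooth (dir_deriv v f)"
  unfolding smooth_def by (metis cont_diff.simps(2))
lemma smooth_differentiable: "smooth f \<Longrightarrow> f differentiable (at p)"
  unfolding smooth_def by (metis cont_diff.simps(2))
lemma smooth_continuous: "smooth f \<Longrightarrow> continuous_on S f"
  unfolding smooth_def by (metis cont_diff.simps(1) continuous_on_subset top_greatest)

lemma smooth_has_real_derivative_line:
  assumes "smooth f"
  shows "((\<lambda>s. f (p + s *\<^sub>R v)) has_real_derivative dir_deriv v f (p + s *\<^sub>R v)) (at s within S)"
proof -
  have 1: "((\<lambda>s. p + s *\<^sub>R v) has_derivative (\<lambda>h. h *\<^sub>R v)) (at s within S)"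
    by (auto intro!: derivative_eq_intros)
  have D: "(f has_derivative (\<lambda>h. dir_deriv h f (p + s *\<^sub>R v))) (at (p + s *\<^sub>R v))"
    by (intro has_derivative_dir_deriv smooth_differentiable assms)
  have "((\<lambda>s. f (p + s *\<^sub>R v)) has_derivative (\<lambda>h. dir_deriv (h *\<^sub>R v) f (p + s *\<^sub>R v))) (at s within S)"
    by (rule has_derivative_compose[OF 1 D])
  moreover have "dir_deriv (h *\<^sub>R v) f (p + s *\<^sub>R v) = dir_deriv v f (p + s *\<^sub>R v) * h" for h
    using linear_scale[OF has_derivative_linear[OF D], of h v] by simp
  ultimately show ?thesis by (simp add: has_field_derivative_def)
qed

lemma smooth_dir_deriv_comb:
  assumes "smooth f"
  shows "dir_deriv (a *\<^sub>R v + b *\<^sub>R w) f p = a * dir_deriv v f p + b * dir_deriv w f p"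
proof -
  have D: "(f has_derivative (\<lambda>v. dir_deriv v f p)) (at p)"
    by (intro has_derivative_dir_deriv smooth_differentiable assms)
  show ?thesis
    using linear_add[OF has_derivative_linear[OF D]] linear_scale[OF has_derivative_linear[OF D]] by simp
qed

text \<open>
  Write f along the w-direction as its initial value plus the integral of its w-derivative;
  differentiating in the v-direction under that integral, and then again in the w-direction,
  gives both orders of differentiation.
\<close>
lemma dir_deriv_commute:
  fixes f :: "'a::real_normed_vector \<Rightarrow> real"
  assumes f: "smooth f"
  shows "dir_deriv v (dir_deriv w f) p = dir_deriv w (dir_deriv v f) p"
proof -
  let ?q = "\<lambda>s r. (p + s *\<^sub>R v) + r *\<^sub>R w"
  have q': "?q s r = (p + r *\<^sub>R w) + s *\<^sub>R v" for s r by (simp add: algebra_simps)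
  have cont: "continuous_on S (\<lambda>x. h (k x))" if "smooth h" "continuous_on S k"
    for h :: "'a \<Rightarrow> real" and k :: "'z::topological_space \<Rightarrow> 'a" and S
    using continuous_on_compose2[OF smooth_continuous[OF that(1), of UNIV] that(2)] by auto
  note sw = smooth_dir_deriv[OF f, of w] and sv = smooth_dir_deriv[OF f, of v]
    and svw = smooth_dir_deriv[OF smooth_dir_deriv[OF f, of w], of v]
    and swv = smooth_dir_deriv[OF smooth_dir_deriv[OF f, of v], of w]
  have I: "dir_deriv v f (?q 0 r) = dir_deriv v f p + integral {0..r} (\<lambda>r. dir_deriv v (dir_deriv w f) (?q 0 r))"
    if "r \<in> {0..1}" for r
  proof -
    have ftc: "f (?q s r) = f (?q s 0) + integral (cbox 0 r) (\<lambda>r. dir_deriv w f (?q s r))" for s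
    proof -
      have "((\<lambda>r. dir_deriv w f (?q s r)) has_integral (f (?q s r) - f (?q s 0))) {0..r}"
        by (rule fundamental_theorem_of_calculus)
           (use that in \<open>auto intro!: smooth_has_real_derivative_line[OF f]
              simp flip: has_real_derivative_iff_has_vector_derivative\<close>)
      then show ?thesis by (simp add: integral_unique)
    qed
    have L: "((\<lambda>s. integral (cbox 0 r) (\<lambda>r. dir_deriv w f (?q s r))) has_real_derivative
        integral (cbox 0 r) (\<lambda>r. dir_deriv v (dir_deriv w f) (?q 0 r))) (at 0 within UNIV)"
    proof (rule leibniz_rule_field_derivative)
      show "((\<lambda>s. dir_deriv w f (?q s r)) has_real_derivative dir_deriv v (dir_deriv w f) (?q s r)) (at s within UNIV)"
        for s r unfolding q' by (rule smooth_has_real_derivative_line[OF sw])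
      show "(\<lambda>r. dir_deriv w f (?q s r)) integrable_on cbox 0 r" for s
        by (intro integrable_continuous cont[OF sw] continuous_intros)
      show "continuous_on (UNIV \<times> cbox 0 r) (\<lambda>(s, r). dir_deriv v (dir_deriv w f) (?q s r))"
        unfolding split_beta by (intro cont[OF svw] continuous_intros)
    qed auto
    have "((\<lambda>s. f (?q s r)) has_real_derivative dir_deriv v f (?q 0 0) + integral (cbox 0 r) (\<lambda>r. dir_deriv v (dir_deriv w f) (?q 0 r))) (at 0)"
      unfolding ftc[abs_def]
      by (intro DERIV_add L) (use smooth_has_real_derivative_line[OF f, of p v 0] in simp)
    moreover have "((\<lambda>s. f (?q s r)) has_real_derivative dir_deriv v f (?q 0 r)) (at 0)"
      unfolding q' by (rule smooth_has_real_derivative_line[OF f])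
    ultimately have "dir_deriv v f (?q 0 r) = dir_deriv v f (?q 0 0) + integral (cbox 0 r) (\<lambda>r. dir_deriv v (dir_deriv w f) (?q 0 r))"
      by (rule DERIV_unique[symmetric])
    then show ?thesis by simp
  qed
  let ?J = "\<lambda>r. dir_deriv v f p + integral {0..r} (\<lambda>r. dir_deriv v (dir_deriv w f) (?q 0 r))"
  have "((\<lambda>r. integral {0..r} (\<lambda>r. dir_deriv v (dir_deriv w f) (?q 0 r))) has_real_derivative
     dir_deriv v (dir_deriv w f) (?q 0 0)) (at 0 within {0..1})"
    by (rule integral_has_real_derivative) (auto intro!: cont[OF svw] continuous_intros)
  then have 1: "(?J has_real_derivative dir_deriv v (dir_deriv w f) p) (at 0 within {0..1})"
    by (auto intro!: derivative_eq_intros)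
  have "((\<lambda>r. dir_deriv v f (?q 0 r)) has_real_derivative dir_deriv w (dir_deriv v f) (?q 0 0)) (at 0 within {0..1})"
    by (rule smooth_has_real_derivative_line[OF sv])
  from has_field_derivative_transform_within[OF this zero_less_one, of ?J]
  have 2: "(?J has_real_derivative dir_deriv w (dir_deriv v f) p) (at 0 within {0..1})"
    using I by auto
  show ?thesis
    by (rule has_field_derivative_unique[OF 1 2]) (simp add: at_within_Icc_at_right)
qed

text \<open>
  On the line every directional derivative is a multiple of the ordinary one, so smoothness can be
  read off from a chain of ordinary derivatives.
\<close>
lemma cont_diff_real_step:
  assumes "\<And>x. (k has_real_derivative k' x) (at x)" "cont_diff n k'"
  shows "cont_diff (Suc n) k"
proof -
  have "dir_deriv v k = (\<lambda>x. k' x * v)" for v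
    by (rule ext, rule dir_deriv_eq[where D="\<lambda>v. k' x * v" for x])
       (use assms(1) in \<open>simp add: has_field_derivative_def\<close>)
  then show ?thesis using assms
    by (auto simp: differentiable_def has_field_derivative_def)
qed

lemma smooth_antiderivative:
  assumes "\<And>x. (k has_real_derivative k' x) (at x)" "smooth k'"
  shows "smooth k"
  using assms cont_diff_real_step cont_diff_Suc_D unfolding smooth_def by blast

lemma smooth_real_sequence:
  assumes "\<And>n x. (K n has_real_derivative K (Suc n) x) (at x)"
  shows "smooth (K n)"
proof -
  have "cont_diff m (K n)" for m n
  proof (induction m arbitrary: n)
    case 0
    show ?case using assms by (auto simp: continuous_on_eq_continuous_within intro: DERIV_isCont)
  qed (use assms cont_diff_real_step in blast)
  then show ?thesis by (simp add: smooth_def)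
qed

text \<open>
  Any compact set outside which f vanishes can stand in for the closure of the support; this is
  how supports are handled below.
\<close>
lemma test_function_iff:
  "test_function U f \<longleftrightarrow> smooth f \<and> (\<exists>K. compact K \<and> K \<subseteq> U \<and> (\<forall>p. p \<notin> K \<longrightarrow> f p = 0))"
proof safe
  assume t: "test_function U f"
  then show "smooth f" by (auto simp: test_function_def smooth_def)
  show "\<exists>K. compact K \<and> K \<subseteq> U \<and> (\<forall>p. p \<notin> K \<longrightarrow> f p = 0)"
    using t closure_subset[of "{p. f p \<noteq> 0}"]
    by (intro exI[of _ "closure {p. f p \<noteq> 0}"]) (auto simp: test_function_def)
next
  fix K assume f: "smooth f" and K: "compact K" "K \<subseteq> U" "\<forall>p. p \<notin> K \<longrightarrow> f p = 0"
  have "closure {p. f p \<noteq> 0} \<subseteq> K"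
    by (rule closure_minimal) (use K compact_imp_closed in auto)
  then show "test_function U f"
    using K f compact_Int_closed[OF K(1), of "closure {p. f p \<noteq> 0}"]
    by (auto simp: test_function_def smooth_def Int_absorb1)
qed

lemma test_functionI:
  "smooth f \<Longrightarrow> compact K \<Longrightarrow> K \<subseteq> U \<Longrightarrow> (\<And>p. p \<notin> K \<Longrightarrow> f p = 0) \<Longrightarrow> test_function U f"
  using test_function_iff by blast

lemma test_function_smooth: "test_function U f \<Longrightarrow> smooth f"
  by (simp add: test_function_iff)

lemma test_function_mono: "test_function U f \<Longrightarrow> U \<subseteq> V \<Longrightarrow> test_function V f"
  unfolding test_function_iff by blast

lemma test_function_UNIV_iff:
  fixes f :: "'a::euclidean_space \<Rightarrow> real"
  shows "test_function UNIV f \<longleftrightarrow> smooth f \<and> (\<exists>B. \<forall>p. norm p > B \<longrightarrow> f p = 0)"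
proof safe
  assume "test_function UNIV f"
  then obtain K where K: "compact K" "\<And>p. p \<notin> K \<Longrightarrow> f p = 0" and f: "smooth f"
    unfolding test_function_iff by blast
  from compact_imp_bounded[OF K(1)] obtain B where "\<And>p. p \<in> K \<Longrightarrow> norm p \<le> B"
    unfolding bounded_iff by blast
  with K show "\<exists>B. \<forall>p. norm p > B \<longrightarrow> f p = 0" by (meson not_le)
  show "smooth f" by (rule f)
next
  fix B assume "smooth f" "\<forall>p. norm p > B \<longrightarrow> f p = 0"
  then show "test_function UNIV f"
    by (intro test_functionI[of _ "cball 0 B"]) auto
qed

lemma test_function_dir_deriv:
  assumes "test_function U f"
  shows "test_function U (dir_deriv v f)"
proof -
  from assms obtain K where K: "compact K" "K \<subseteq> U" "\<And>p. p \<notin> K \<Longrightarrow> f p = 0" and f: "smooth f"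
    unfolding test_function_iff by blast
  have "dir_deriv v f p = 0" if "p \<notin> K" for p
  proof (rule dir_deriv_eq[where D="\<lambda>_. 0", simplified])
    have "open (-K)" by (intro open_Compl compact_imp_closed K(1))
    then show "(f has_derivative (\<lambda>_. 0)) (at p)"
      by (rule has_derivative_transform_within_open[where f="\<lambda>_. 0", rotated])
         (use that K in auto)
  qed
  then show ?thesis
    using K f by (intro test_functionI[of _ K] smooth_dir_deriv) auto
qed

lemma test_function_diff:
  assumes "test_function U f" "test_function U g"
  shows "test_function U (\<lambda>p. f p - g p)"
proof -
  from assms obtain K L where "compact K" "K \<subseteq> U" "\<And>p. p \<notin> K \<Longrightarrow> f p = 0"
    "compact L" "L \<subseteq> U" "\<And>p. p \<notin> L \<Longrightarrow> g p = 0" "smooth f" "smooth g"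
    unfolding test_function_iff by metis
  then show ?thesis
    by (intro test_functionI[of _ "K \<union> L"] smooth_diff) auto
qed

lemma test_function_cmult:
  "test_function U f \<Longrightarrow> test_function U (\<lambda>p. c * f p)"
  unfolding test_function_iff by (auto intro: smooth_cmult)

text \<open>
  An injective linear map is bounded below, so the preimage of a bounded support is bounded. Besides
  changes of variables this covers time slices, where the plane is embedded into space-time.
\<close>
lemma test_function_affine:
  fixes f :: "'a::euclidean_space \<Rightarrow> real" and A :: "'b::euclidean_space \<Rightarrow> 'a"
  assumes f: "test_function UNIV f" and A: "linear A" "inj A"
  shows "test_function UNIV (\<lambda>x. f (A x + b))"
proof -
  from f obtain B where B: "\<And>p. norm p > B \<Longrightarrow> f p = 0" and sf: "smooth f"
    unfolding test_function_UNIV_iff by blast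
  from linear_inj_bounded_below_pos[OF A] obtain e where e: "e > 0" "\<And>x. e * norm x \<le> norm (A x)"
    by blast
  have "f (A x + b) = 0" if "norm x > (\<bar>B\<bar> + norm b) / e" for x
  proof (rule B)
    have "B + norm b < e * norm x" using that e by (simp add: field_simps)
    also have "\<dots> \<le> norm (A x)" by (rule e)
    also have "\<dots> \<le> norm (A x + b) + norm b" using norm_triangle_ineq4[of "A x + b" b] by simp
    finally show "B < norm (A x + b)" by simp
  qed
  with sf A show ?thesis
    unfolding test_function_UNIV_iff by (auto intro: smooth_affine linear_conv_bounded_linear[THEN iffD1])
qed

lemma test_function_bounded:
  assumes "test_function U f"
  obtains C where "\<And>p. \<bar>f p\<bar> \<le> C"
proof -
  from assms obtain K where K: "compact K" "\<And>p. p \<notin> K \<Longrightarrow> f p = 0" and f: "smooth f"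
    unfolding test_function_iff by blast
  have "bounded (f ` K)"
    by (intro compact_imp_bounded compact_continuous_image smooth_continuous f K)
  then obtain C where "\<And>p. p \<in> K \<Longrightarrow> \<bar>f p\<bar> \<le> C" unfolding bounded_iff by auto
  then have "\<bar>f p\<bar> \<le> \<bar>C\<bar>" for p using K(2)[of p] by (cases "p \<in> K") force+
  then show ?thesis using that by blast
qed

section \<open>A smooth cut-off function\<close>

text \<open>
  The functions \<open>q (1/x) exp (- 1/x)\<close> for \<open>x > 0\<close>, extended by zero. For \<open>q = 1\<close> this is the classical
  smooth function that is flat at the origin; the polynomial factor makes the family closed
  under differentiation.
\<close>
definition flat :: "real poly \<Rightarrow> real \<Rightarrow> real" where
  "flat q x = (if x > 0 then poly q (inverse x) * exp (- inverse x) else 0)"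

lemma poly_mult_exp_minus_tendsto_0:
  "((\<lambda>y::real. poly q y * exp (- y)) \<longlongrightarrow> 0) at_top"
proof -
  have "((\<lambda>y::real. y ^ k * poly q y * exp (- y)) \<longlongrightarrow> 0) at_top" for k
  proof (induction q arbitrary: k)
    case (pCons a q)
    have "((\<lambda>y. a * (y ^ k / exp y) + y ^ Suc k * poly q y * exp (-y)) \<longlongrightarrow> a * 0 + 0) at_top"
      by (intro tendsto_intros tendsto_power_div_exp_0 pCons)
    then show ?case by (simp add: algebra_simps exp_minus divide_inverse)
  qed simp
  from this[of 0] show ?thesis by simp
qed

text \<open>
  Away from 0 this is the product rule. At 0 the difference quotient is again of the form
  \<open>poly (1/x) exp (- 1/x)\<close>, which tends to 0.
\<close>
lemma flat_has_derivative:
  "(flat q has_real_derivative flat ([:0,0,1:] * (q - pderiv q)) x) (at x)"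
proof -
  consider "x > 0" | "x < 0" | "x = 0" by linarith
  then show ?thesis
  proof cases
    case 1
    have "((\<lambda>x. poly q (inverse x) * exp (- inverse x)) has_real_derivative
        flat ([:0,0,1:] * (q - pderiv q)) x) (at x)"
      using 1 by (auto intro!: derivative_eq_intros DERIV_chain2[OF poly_DERIV]
          simp: flat_def algebra_simps power2_eq_square)
    then show ?thesis
      by (rule has_field_derivative_transform_within_open[where S="{0<..}"])
         (use 1 in \<open>auto simp: flat_def\<close>)
  next
    case 2
    show ?thesis
      by (rule has_field_derivative_transform_within_open[where S="{..<0}" and f="\<lambda>_. 0"])
         (use 2 in \<open>auto simp: flat_def\<close>)
  next
    case 3
    have "((\<lambda>h. flat q h / h) \<longlongrightarrow> 0) (at_right 0)"
    proof (rule Lim_transform_eventually)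
      show "((\<lambda>x. poly (pCons 0 q) (inverse x) * exp (- inverse x)) \<longlongrightarrow> 0) (at_right (0::real))"
        by (rule filterlim_compose[OF poly_mult_exp_minus_tendsto_0 filterlim_inverse_at_top_right])
      show "\<forall>\<^sub>F x in at_right 0. poly (pCons 0 q) (inverse x) * exp (- inverse x) = flat q x / x"
        by (auto simp: eventually_at_right_field flat_def field_simps intro!: exI[of _ 1])
    qed
    moreover have "((\<lambda>h. flat q h / h) \<longlongrightarrow> 0) (at_left 0)"
      by (rule Lim_transform_eventually[where f="\<lambda>_. 0"])
         (auto simp: eventually_at_left_field flat_def intro!: exI[of _ "-1"])
    ultimately have "((\<lambda>h. flat q h / h) \<longlongrightarrow> 0) (at 0)"
      by (simp add: filterlim_split_at)
    then show ?thesis using 3 by (simp add: has_field_derivative_iff flat_def)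
  qed
qed

lemma smooth_flat: "smooth (flat q)"
  using smooth_real_sequence[of "\<lambda>n. flat (((\<lambda>q. [:0,0,1:] * (q - pderiv q)) ^^ n) q)" 0]
    flat_has_derivative by simp

definition ramp :: "real \<Rightarrow> real" where "ramp = flat 1"

lemma ramp_eq: "ramp x = (if x > 0 then exp (- inverse x) else 0)"
  by (simp add: ramp_def flat_def)
lemma smooth_ramp: "smooth ramp" by (simp add: ramp_def smooth_flat)
lemma ramp_nonneg: "0 \<le> ramp x" and ramp_le_1: "ramp x \<le> 1" and ramp_pos: "x > 0 \<Longrightarrow> ramp x > 0"
  and ramp_zero: "x \<le> 0 \<Longrightarrow> ramp x = 0"
  by (auto simp: ramp_eq)

text \<open>
  Rescaled ramps approach the indicator of the positive half-line; products of four of them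
  approach the indicator of a rectangle from inside.
\<close>
lemma ramp_scaled_tendsto: "(\<lambda>n. ramp (real n * x)) \<longlonglongrightarrow> (if x > 0 then 1 else 0)"
proof (cases "x > 0")
  case True
  have "(\<lambda>n. exp (- (inverse x * inverse (real n)))) \<longlonglongrightarrow> exp (- (inverse x * 0))"
    by (intro tendsto_intros lim_inverse_n)
  then have "(\<lambda>n. exp (- inverse (real n * x))) \<longlonglongrightarrow> 1"
    by (simp add: mult.commute)
  then show ?thesis
  proof (rule Lim_transform_eventually[of _ _ sequentially "\<lambda>n. ramp (real n * x)", THEN back_subst[of "\<lambda>c. (_ \<longlonglongrightarrow> c)"]])
    show "\<forall>\<^sub>F n in sequentially. exp (- inverse (real n * x)) = ramp (real n * x)"
      using eventually_gt_at_top[of 0] by eventually_elim (use True in \<open>simp add: ramp_eq\<close>)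
  qed (use True in auto)
qed (auto simp: ramp_zero mult_nonneg_nonpos)

section \<open>Square-integrable functions on the plane\<close>

text \<open>
  With \<open>\<sigma> = 1\<close> this is the translation by s; with \<open>\<sigma> = -1\<close> and \<open>s = (2 * a, 0)\<close> it is the
  reflection at the line \<open>x = a\<close>. Both are needed, and every invariance below has one proof for the two.
\<close>
definition aff :: "real \<Rightarrow> real \<times> real \<Rightarrow> real \<times> real \<Rightarrow> real \<times> real" where
  "aff \<sigma> s p = s + (\<sigma> * fst p, snd p)"

lemma aff_1 [simp]: "aff 1 s p = s + p" by (simp add: aff_def)

lemma
  assumes "\<bar>\<sigma>\<bar> = 1"
  shows distr_aff: "distr lebesgue lebesgue (aff \<sigma> s) = lebesgue"
    and measurable_aff [measurable]: "aff \<sigma> s \<in> lebesgue \<rightarrow>\<^sub>M lebesgue"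
proof -
  let ?c = "\<lambda>j::real \<times> real. if j = (1, 0) then \<sigma> else 1"
  have c: "?c j \<noteq> 0" for j using assms by auto
  have T: "(\<lambda>x. s + (\<Sum>j\<in>Basis. (?c j * (x \<bullet> j)) *\<^sub>R j)) = aff \<sigma> s"
    by (auto simp: aff_def Basis_prod_def fun_eq_iff sum.union_disjoint)
  have p: "(\<Prod>j\<in>Basis. \<bar>?c j\<bar>) = 1"
    using assms by (intro prod.neutral) auto
  show "aff \<sigma> s \<in> lebesgue \<rightarrow>\<^sub>M lebesgue"
    using lebesgue_affine_measurable[of ?c s] c unfolding T by blast
  have "lebesgue = density (distr lebesgue lebesgue (aff \<sigma> s)) (\<lambda>_. ennreal 1)"
    using lebesgue_affine_euclidean[of ?c s] c unfolding T p by blast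
  then show "distr lebesgue lebesgue (aff \<sigma> s) = lebesgue"
    by (simp add: density_1)
qed

lemma integral_aff:
  fixes f :: "real \<times> real \<Rightarrow> real"
  assumes "\<bar>\<sigma>\<bar> = 1" "f \<in> borel_measurable lebesgue"
  shows "(LINT p|lebesgue. f (aff \<sigma> s p)) = (LINT p|lebesgue. f p)"
  using integral_distr[OF measurable_aff[OF assms(1)] assms(2)] by (simp add: distr_aff[OF assms(1)])

lemma integrable_aff:
  fixes f :: "real \<times> real \<Rightarrow> real"
  assumes "\<bar>\<sigma>\<bar> = 1" "integrable lebesgue f"
  shows "integrable lebesgue (\<lambda>p. f (aff \<sigma> s p))"
  by (rule integrable_distr[OF measurable_aff[OF assms(1)]]) (simp add: distr_aff assms)

lemma measurable_compose_aff:
  "\<bar>\<sigma>\<bar> = 1 \<Longrightarrow> f \<in> borel_measurable lebesgue \<Longrightarrow> (\<lambda>p. f (aff \<sigma> s p)) \<in> borel_measurable lebesgue"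
  by (rule measurable_compose[OF measurable_aff])

lemma L2_measurable: "L2 f \<Longrightarrow> f \<in> borel_measurable lebesgue" by (simp add: L2_def)
lemma L2_integrable_square: "L2 f \<Longrightarrow> integrable lebesgue (\<lambda>p. (f p)\<^sup>2)" by (simp add: L2_def)

lemma L2_aff:
  assumes "\<bar>\<sigma>\<bar> = 1" "L2 f" shows "L2 (\<lambda>p. f (aff \<sigma> s p))"
  using assms measurable_compose_aff[OF assms(1)] integrable_aff[OF assms(1), of "\<lambda>p. (f p)\<^sup>2"]
  by (auto simp: L2_def)

text \<open>
  The elementary bound \<open>\<bar>a * b\<bar> \<le> a\<^sup>2 + b\<^sup>2\<close> provides the integrable majorant.
\<close>
lemma integrable_mult_L2:
  assumes "L2 f" "L2 g" shows "integrable lebesgue (\<lambda>p. f p * g p)"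
proof (rule Bochner_Integration.integrable_bound)
  show "integrable lebesgue (\<lambda>p. (f p)\<^sup>2 + (g p)\<^sup>2)"
    using assms by (auto simp: L2_def)
  have "\<bar>a * b\<bar> \<le> a\<^sup>2 + b\<^sup>2" for a b :: real
    using sum_squares_bound[of "\<bar>a\<bar>" "\<bar>b\<bar>"] mult_nonneg_nonneg[of "\<bar>a\<bar>" "\<bar>b\<bar>"]
    unfolding abs_mult power2_abs by linarith
  then show "AE p in lebesgue. norm (f p * g p) \<le> norm ((f p)\<^sup>2 + (g p)\<^sup>2)"
    by simp
qed (use assms in \<open>auto simp: L2_def\<close>)

lemma L2_add:
  assumes "L2 f" "L2 g" shows "L2 (\<lambda>p. f p + g p)"
proof -
  have "integrable lebesgue (\<lambda>p. (f p)\<^sup>2 + (g p)\<^sup>2 + 2 * (f p * g p))"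
    using assms integrable_mult_L2[OF assms] by (auto simp: L2_def)
  then have "integrable lebesgue (\<lambda>p. (f p + g p)\<^sup>2)"
    by (simp add: power2_sum algebra_simps)
  then show ?thesis using assms by (auto simp: L2_def)
qed

lemma L2_mult_bounded:
  assumes "L2 f" "h \<in> borel_measurable lebesgue" "\<And>p. \<bar>h p\<bar> \<le> C"
  shows "L2 (\<lambda>p. f p * h p)"
proof -
  have "integrable lebesgue (\<lambda>p. (f p * h p)\<^sup>2)"
  proof (rule Bochner_Integration.integrable_bound)
    show "integrable lebesgue (\<lambda>p. C\<^sup>2 * (f p)\<^sup>2)" using assms(1) by (simp add: L2_def)
    have "(f p * h p)\<^sup>2 \<le> C\<^sup>2 * (f p)\<^sup>2" for p
    proof -
      have "(h p)\<^sup>2 \<le> C\<^sup>2" using power_mono[OF assms(3)[of p], of 2] by simp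
      from mult_right_mono[OF this, of "(f p)\<^sup>2"] show ?thesis by (simp add: power_mult_distrib mult.commute)
    qed
    then show "AE p in lebesgue. norm ((f p * h p)\<^sup>2) \<le> norm (C\<^sup>2 * (f p)\<^sup>2)" by simp
  qed (use assms(1,2) L2_measurable in measurable)
  then show ?thesis using assms(2) L2_measurable[OF assms(1)] by (auto simp: L2_def)
qed

lemma L2_cmult: "L2 f \<Longrightarrow> L2 (\<lambda>p. c * f p)"
  using L2_mult_bounded[of f "\<lambda>_. c" "\<bar>c\<bar>"] by (simp add: mult.commute)

lemma L2_diff: "L2 f \<Longrightarrow> L2 g \<Longrightarrow> L2 (\<lambda>p. f p - g p)"
  using L2_add[of f "\<lambda>p. -1 * g p"] L2_cmult[of g "-1"] by simp

lemma L2_indicator: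
  assumes "S \<in> lmeasurable" shows "L2 (indicat_real S)"
proof -
  have "(\<lambda>p. (indicat_real S p)\<^sup>2) = indicat_real S" by (auto simp: indicator_def)
  then show ?thesis using assms by (auto simp: L2_def fmeasurable_def)
qed

lemma measurable_continuous_lebesgue:
  fixes f :: "real \<times> real \<Rightarrow> real"
  shows "continuous_on UNIV f \<Longrightarrow> f \<in> borel_measurable lebesgue"
  by (intro measurable_completion) (simp add: borel_measurable_continuous_onI)

lemma test_function_measurable:
  fixes f :: "real \<times> real \<Rightarrow> real"
  shows "test_function U f \<Longrightarrow> f \<in> borel_measurable lebesgue"
  by (intro measurable_continuous_lebesgue smooth_continuous test_function_smooth)

lemma L2_mult_test: "L2 f \<Longrightarrow> test_function U h \<Longrightarrow> L2 (\<lambda>p. f p * h p)"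
  by (metis L2_mult_bounded test_function_bounded test_function_measurable)

lemma L2_test_function:
  assumes "test_function UNIV f" shows "L2 f"
proof -
  obtain B where B: "\<And>p. norm p > B \<Longrightarrow> f p = 0"
    using assms unfolding test_function_UNIV_iff by blast
  have "(\<lambda>p. indicat_real (cball 0 B) p * f p) = f"
  proof
    show "indicat_real (cball 0 B) p * f p = f p" for p using B[of p] by (cases "norm p \<le> B") auto
  qed
  with L2_mult_test[OF L2_indicator[of "cball 0 B"] assms] show ?thesis by simp
qed

text \<open>
  The integral of \<open>(f + s * g)\<^sup>2\<close> is a quadratic in s that is nowhere negative, hence its discriminant
  is not positive.
\<close>
lemma Cauchy_Schwarz_L2:
  assumes f: "L2 f" and g: "L2 g"
  shows "\<bar>LINT p|lebesgue. f p * g p\<bar> \<le> sqrt (LINT p|lebesgue. (f p)\<^sup>2) * sqrt (LINT p|lebesgue. (g p)\<^sup>2)"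
proof -
  define A B C where "A = (LINT p|lebesgue. (f p)\<^sup>2)" and "B = (LINT p|lebesgue. f p * g p)"
    and "C = (LINT p|lebesgue. (g p)\<^sup>2)"
  have q: "0 \<le> A + 2 * s * B + s\<^sup>2 * C" for s
  proof -
    have "0 \<le> (LINT p|lebesgue. (f p + s * g p)\<^sup>2)" by simp
    also have "\<dots> = (LINT p|lebesgue. (f p)\<^sup>2 + 2 * s * (f p * g p) + s\<^sup>2 * (g p)\<^sup>2)"
      by (simp add: power2_sum power_mult_distrib algebra_simps)
    also have "\<dots> = A + 2 * s * B + s\<^sup>2 * C"
      unfolding A_def B_def C_def
      using integrable_mult_L2[OF f g] L2_integrable_square[OF f] L2_integrable_square[OF g] by simp
    finally show ?thesis .
  qed
  have C: "C \<ge> 0" by (simp add: C_def)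
  have "B\<^sup>2 \<le> A * C"
  proof (cases "C = 0")
    case True
    have "B = 0"
    proof (rule ccontr)
      assume "B \<noteq> 0"
      then have "2 * (- (A + 1) / (2 * B)) * B = - (A + 1)" by simp
      then show False using q[of "- (A + 1) / (2 * B)"] True by simp
    qed
    then show ?thesis using True by simp
  next
    case False
    then have "C > 0" using C by simp
    define s where "s = - B / C"
    have s: "C * s = - B" using False by (simp add: s_def)
    have "0 \<le> C * (A + 2 * s * B + s\<^sup>2 * C)"
      by (rule mult_nonneg_nonneg[OF C q])
    also have "\<dots> = A * C + 2 * (C * s) * B + (C * s)\<^sup>2" by (simp only: power2_eq_square) (simp only: algebra_simps)
    also have "\<dots> = A * C - B\<^sup>2" unfolding s by (simp add: power2_eq_square)
    finally show ?thesis by simp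
  qed
  then have "sqrt (B\<^sup>2) \<le> sqrt (A * C)" by (rule real_sqrt_le_mono)
  then show ?thesis unfolding A_def B_def C_def by (simp add: real_sqrt_mult)
qed

definition L2_tendsto :: "('i \<Rightarrow> real \<times> real \<Rightarrow> real) \<Rightarrow> (real \<times> real \<Rightarrow> real) \<Rightarrow> 'i filter \<Rightarrow> bool" where
  "L2_tendsto f f0 F \<longleftrightarrow> ((\<lambda>i. LINT p|lebesgue. (f i p - f0 p)\<^sup>2) \<longlongrightarrow> 0) F"

lemma L2_tendsto_const [simp]: "L2_tendsto (\<lambda>_. f) f F"
  by (simp add: L2_tendsto_def)

text \<open>
  All continuity statements for the bilinear and quadratic terms of the weak formulation are
  instances of this one. The difference of the products is split as
  \<open>(f - f0) (g - g0) + f0 (g - g0) + (f - f0) g0\<close>, and Cauchy-Schwarz is applied to each term.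
\<close>
lemma L2_tendsto_inner:
  assumes f: "L2_tendsto f f0 F" "\<And>i. i \<in> S \<Longrightarrow> L2 (f i)" "L2 f0"
    and g: "L2_tendsto g g0 F" "\<And>i. i \<in> S \<Longrightarrow> L2 (g i)" "L2 g0"
    and S: "\<forall>\<^sub>F i in F. i \<in> S"
  shows "((\<lambda>i. LINT p|lebesgue. f i p * g i p) \<longlongrightarrow> (LINT p|lebesgue. f0 p * g0 p)) F"
proof -
  define n where "n h = sqrt (LINT p|lebesgue. (h p)\<^sup>2)" for h :: "real \<times> real \<Rightarrow> real"
  let ?f = "\<lambda>i p. f i p - f0 p" and ?g = "\<lambda>i p. g i p - g0 p"
  have nf: "((\<lambda>i. n (?f i)) \<longlongrightarrow> 0) F" and ng: "((\<lambda>i. n (?g i)) \<longlongrightarrow> 0) F"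
    using tendsto_real_sqrt[OF f(1)[unfolded L2_tendsto_def]] tendsto_real_sqrt[OF g(1)[unfolded L2_tendsto_def]]
    by (simp_all add: n_def)
  have "((\<lambda>i. n (?f i) * n (?g i) + n f0 * n (?g i) + n (?f i) * n g0) \<longlongrightarrow> 0 * 0 + n f0 * 0 + 0 * n g0) F"
    by (intro tendsto_intros nf ng)
  then have lim: "((\<lambda>i. n (?f i) * n (?g i) + n f0 * n (?g i) + n (?f i) * n g0) \<longlongrightarrow> 0) F" by simp
  have "((\<lambda>i. (LINT p|lebesgue. f i p * g i p) - (LINT p|lebesgue. f0 p * g0 p)) \<longlongrightarrow> 0) F"
  proof (rule Lim_null_comparison[OF _ lim])
    show "\<forall>\<^sub>F i in F. norm ((LINT p|lebesgue. f i p * g i p) - (LINT p|lebesgue. f0 p * g0 p))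
       \<le> n (?f i) * n (?g i) + n f0 * n (?g i) + n (?f i) * n g0"
      using S
    proof eventually_elim
      case (elim i)
      note L = f(2)[OF elim] f(3) g(2)[OF elim] g(3)
      note D = L2_diff[OF L(1,2)] L2_diff[OF L(3,4)]
      have "(LINT p|lebesgue. f i p * g i p) - (LINT p|lebesgue. f0 p * g0 p)
        = (LINT p|lebesgue. f i p * g i p - f0 p * g0 p)"
        by (simp add: integrable_mult_L2 L)
      also have "\<dots> = (LINT p|lebesgue. ?f i p * ?g i p + f0 p * ?g i p + ?f i p * g0 p)"
        by (simp add: algebra_simps)
      also have "\<dots> = (LINT p|lebesgue. ?f i p * ?g i p) + (LINT p|lebesgue. f0 p * ?g i p) + (LINT p|lebesgue. ?f i p * g0 p)"
        using integrable_mult_L2[OF D] integrable_mult_L2[OF L(2) D(2)] integrable_mult_L2[OF D(1) L(4)]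
        by simp
      finally have eq: "(LINT p|lebesgue. f i p * g i p) - (LINT p|lebesgue. f0 p * g0 p)
        = (LINT p|lebesgue. ?f i p * ?g i p) + (LINT p|lebesgue. f0 p * ?g i p) + (LINT p|lebesgue. ?f i p * g0 p)" .
      show ?case
        unfolding eq
        using Cauchy_Schwarz_L2[OF D] Cauchy_Schwarz_L2[OF L(2) D(2)] Cauchy_Schwarz_L2[OF D(1) L(4)]
        unfolding n_def real_norm_def by linarith
    qed
  qed
  then show ?thesis by (rule LIM_zero_cancel)
qed

lemma L2_tendsto_mult_bounded:
  assumes f: "L2_tendsto f f0 F" "\<And>i. i \<in> S \<Longrightarrow> L2 (f i)" "L2 f0" and S: "\<forall>\<^sub>F i in F. i \<in> S"
    and h: "h \<in> borel_measurable lebesgue" "\<And>p. \<bar>h p\<bar> \<le> C"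
  shows "L2_tendsto (\<lambda>i p. f i p * h p) (\<lambda>p. f0 p * h p) F"
  unfolding L2_tendsto_def
proof (rule Lim_null_comparison)
  show "((\<lambda>i. C\<^sup>2 * (LINT p|lebesgue. (f i p - f0 p)\<^sup>2)) \<longlongrightarrow> 0) F"
    using tendsto_mult_left[OF f(1)[unfolded L2_tendsto_def], of "C\<^sup>2"] by simp
  show "\<forall>\<^sub>F i in F. norm (LINT p|lebesgue. (f i p * h p - f0 p * h p)\<^sup>2) \<le> C\<^sup>2 * (LINT p|lebesgue. (f i p - f0 p)\<^sup>2)"
    using S
  proof eventually_elim
    case (elim i)
    have D: "L2 (\<lambda>p. f i p - f0 p)" by (intro L2_diff f elim)
    have "(LINT p|lebesgue. (f i p * h p - f0 p * h p)\<^sup>2) \<le> (LINT p|lebesgue. C\<^sup>2 * (f i p - f0 p)\<^sup>2)"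
    proof (rule integral_mono)
      show "integrable lebesgue (\<lambda>p. (f i p * h p - f0 p * h p)\<^sup>2)"
        using L2_mult_bounded[OF D h] by (simp add: L2_def algebra_simps)
      show "integrable lebesgue (\<lambda>p. C\<^sup>2 * (f i p - f0 p)\<^sup>2)" using D by (auto simp: L2_def)
      show "(f i p * h p - f0 p * h p)\<^sup>2 \<le> C\<^sup>2 * (f i p - f0 p)\<^sup>2" for p
      proof -
        have "(h p)\<^sup>2 \<le> C\<^sup>2" using power_mono[OF h(2)[of p], of 2] by simp
        from mult_right_mono[OF this zero_le_power2, of "f i p - f0 p"] show ?thesis
          by (simp only: left_diff_distrib[symmetric] power_mult_distrib) (simp only: mult.commute)
      qed
    qed
    then show ?case by simp
  qed
qed

section \<open>Continuity of translations in mean square\<close>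

text \<open>
  Lets the modulus of continuity of translations be computed on an approximation g of f: the error
  is twice the distance of f and g because translations preserve the integral.
\<close>
lemma translation_L1_perturb:
  fixes f g :: "real \<times> real \<Rightarrow> real"
  assumes f: "integrable lebesgue f" and g: "integrable lebesgue g"
  shows "(LINT p|lebesgue. \<bar>f (s + p) - f p\<bar>)
    \<le> (LINT p|lebesgue. \<bar>g (s + p) - g p\<bar>) + 2 * (LINT p|lebesgue. \<bar>f p - g p\<bar>)"
proof -
  note T = integrable_aff[of 1, simplified]
  have fs: "integrable lebesgue (\<lambda>p. f (s + p))" and gs: "integrable lebesgue (\<lambda>p. g (s + p))"
    using T f g by blast+
  have shift: "(LINT p|lebesgue. \<bar>f (s + p) - g (s + p)\<bar>) = (LINT p|lebesgue. \<bar>f p - g p\<bar>)"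
    using integral_aff[of 1 "\<lambda>p. \<bar>f p - g p\<bar>" s] f g by simp
  have "(LINT p|lebesgue. \<bar>f (s + p) - f p\<bar>)
    \<le> (LINT p|lebesgue. \<bar>g (s + p) - g p\<bar> + \<bar>f (s + p) - g (s + p)\<bar> + \<bar>f p - g p\<bar>)"
    by (rule integral_mono) (use f g fs gs in \<open>auto intro!: Bochner_Integration.integrable_add integrable_abs Bochner_Integration.integrable_diff\<close>)
  also have "\<dots> = (LINT p|lebesgue. \<bar>g (s + p) - g p\<bar>) + (LINT p|lebesgue. \<bar>f (s + p) - g (s + p)\<bar>)
      + (LINT p|lebesgue. \<bar>f p - g p\<bar>)"
    using f g fs gs by simp
  finally show ?thesis using shift by simp
qed

text \<open>
  Squeeze A between a compact K and an open U with \<open>U - K\<close> of small measure. A small translation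
  keeps K inside U, so a point where the two indicators differ lies in \<open>U - K\<close> or is moved into it.
\<close>
lemma translation_L1_indicator:
  fixes A :: "(real \<times> real) set"
  assumes A: "A \<in> lmeasurable"
  shows "((\<lambda>s. LINT p|lebesgue. \<bar>indicat_real A (s + p) - indicat_real A p\<bar>) \<longlongrightarrow> 0) (at 0)"
proof (rule tendstoI)
  fix e :: real assume "e > 0"
  then have e3: "e / 6 > 0" by simp
  have As: "A \<in> sets lebesgue" using A by blast
  obtain U where U: "open U" "A \<subseteq> U" "U - A \<in> lmeasurable" "emeasure lebesgue (U - A) < ennreal (e / 6)"
    using sets_lebesgue_outer_open[OF As e3] by metis
  obtain T where T: "closed T" "T \<subseteq> A" "A - T \<in> lmeasurable" "emeasure lebesgue (A - T) < ennreal (e / 6)"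
    using sets_lebesgue_inner_closed[OF As e3] by metis
  have mUA: "measure lebesgue (U - A) < e / 6" and mAT: "measure lebesgue (A - T) < e / 6"
    using U(3,4) T(3,4) e3 by (auto simp: emeasure_eq_measure2 ennreal_less_iff)
  have Tm: "T \<in> lmeasurable"
    using fmeasurable_Diff[OF A, of "A - T"] T by (simp add: double_diff)
  \<comment> \<open>Regularity from inside yields a closed set only; cutting off at a large radius makes it compact.\<close>
  define Tn where "Tn n = T \<inter> cball 0 (real n)" for n
  have "(\<lambda>n. measure lebesgue (Tn n)) \<longlonglongrightarrow> measure lebesgue (\<Union>n. Tn n)"
  proof (rule Lim_measure_incseq)
    show "range Tn \<subseteq> sets lebesgue" using T(1) by (auto simp: Tn_def)
    show "incseq Tn" by (auto simp: incseq_def Tn_def)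
    have "(\<Union>n. Tn n) \<subseteq> T" by (auto simp: Tn_def)
    then show "emeasure lebesgue (\<Union>n. Tn n) \<noteq> \<infinity>"
      using Tm emeasure_mono[of "\<Union>n. Tn n" T lebesgue] by (auto simp: fmeasurable_def top_unique)
  qed
  moreover have "(\<Union>n. Tn n) = T" by (auto simp: Tn_def real_arch_simple)
  ultimately have "\<forall>\<^sub>F n in sequentially. measure lebesgue (Tn n) > measure lebesgue T - e / 6"
    using e3 by (intro order_tendstoD(1)) auto
  then obtain n where n: "measure lebesgue (Tn n) > measure lebesgue T - e / 6"
    by (auto simp: eventually_sequentially)
  define K where "K = Tn n"
  have K: "compact K" "K \<subseteq> T"
    using T(1) by (auto simp: K_def Tn_def intro: closed_Int_compact)
  have Km: "K \<in> lmeasurable" using K(1) by (rule lmeasurable_compact)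
  have mTK: "measure lebesgue (T - K) < e / 6"
    using n measurable_measure_Diff[OF Tm, of K] Km K(2) by (simp add: K_def fmeasurableD)
  have mUK: "U - K \<in> lmeasurable" "measure lebesgue (U - K) < e / 2"
  proof -
    have eq: "U - K = (U - A) \<union> ((A - T) \<union> (T - K))" using U T K by auto
    have TK: "T - K \<in> lmeasurable" using Tm Km by (simp add: fmeasurable_Diff)
    show "U - K \<in> lmeasurable" unfolding eq using U(3) T(3) TK by blast
    have "measure lebesgue (U - K) \<le> measure lebesgue (U - A) + (measure lebesgue (A - T) + measure lebesgue (T - K))"
      unfolding eq using U(3) T(3) TK
      by (intro order_trans[OF measure_Un_le] add_left_mono measure_Un_le) auto
    then show "measure lebesgue (U - K) < e / 2" using mUA mAT mTK by linarith
  qed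
  have "K \<subseteq> U" using K T U by blast
  then obtain d where d: "d > 0" "(\<Union>x\<in>K. ball x d) \<subseteq> U"
    using compact_subset_open_imp_ball_epsilon_subset[OF K(1) U(1)] by blast
  have iUK: "integrable lebesgue (indicat_real (U - K))" using mUK by (simp add: lmeasurable_iff_integrable)
  have iA: "integrable lebesgue (indicat_real A)" using A by (simp add: lmeasurable_iff_integrable)
  note iUKs = integrable_aff[of 1 "indicat_real (U - K)", simplified, OF iUK]
  note iAs = integrable_aff[of 1 "indicat_real A", simplified, OF iA]
  have "dist (LINT p|lebesgue. \<bar>indicat_real A (s + p) - indicat_real A p\<bar>) 0 < e" if s: "norm s < d" for s
  proof -
    have KU: "s + p \<in> U" if "p \<in> K" for p
      using d(2) that s by (auto simp: subset_eq dist_norm)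
    have KU': "p \<in> U" if "s + p \<in> K" for p
      using d(2) that s by (force simp: subset_eq dist_norm)
    have "(LINT p|lebesgue. \<bar>indicat_real A (s + p) - indicat_real A p\<bar>)
      \<le> (LINT p|lebesgue. indicat_real (U - K) (s + p) + indicat_real (U - K) p)"
    proof (rule integral_mono)
      show "integrable lebesgue (\<lambda>p. \<bar>indicat_real A (s + p) - indicat_real A p\<bar>)"
        using iAs iA by auto
      show "integrable lebesgue (\<lambda>p. indicat_real (U - K) (s + p) + indicat_real (U - K) p)"
        using iUKs iUK by auto
      show "\<bar>indicat_real A (s + p) - indicat_real A p\<bar> \<le> indicat_real (U - K) (s + p) + indicat_real (U - K) p" for p
        using KU[of p] KU'[of p] U(2) T(2) K(2) by (auto simp: indicator_def)
    qed
    also have "\<dots> = (LINT p|lebesgue. indicat_real (U - K) (s + p)) + (LINT p|lebesgue. indicat_real (U - K) p)"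
      using iUKs iUK by simp
    also have "(LINT p|lebesgue. indicat_real (U - K) (s + p)) = (LINT p|lebesgue. indicat_real (U - K) p)"
      using integral_aff[of 1 "indicat_real (U - K)" s] mUK(1) by simp
    also have "(LINT p|lebesgue. indicat_real (U - K) p) = measure lebesgue (U - K)"
      using mUK(1) by simp
    finally have "(LINT p|lebesgue. \<bar>indicat_real A (s + p) - indicat_real A p\<bar>) < e"
      using mUK(2) by linarith
    then show ?thesis by simp
  qed
  then show "\<forall>\<^sub>F s in at 0. dist (LINT p|lebesgue. \<bar>indicat_real A (s + p) - indicat_real A p\<bar>) 0 < e"
    using d(1) by (auto simp: eventually_at dist_norm)
qed

lemma translation_L1_continuous:
  fixes f :: "real \<times> real \<Rightarrow> real"
  assumes "integrable lebesgue f"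
  shows "((\<lambda>s. LINT p|lebesgue. \<bar>f (s + p) - f p\<bar>) \<longlongrightarrow> 0) (at 0)"
  using assms
proof (induct rule: integrable_induct)
  case (base A c)
  have eq: "(LINT p|lebesgue. \<bar>indicat_real A (s + p) *\<^sub>R c - indicat_real A p *\<^sub>R c\<bar>)
    = (LINT p|lebesgue. \<bar>indicat_real A (s + p) - indicat_real A p\<bar>) * \<bar>c\<bar>" for s
    by (simp add: abs_mult flip: left_diff_distrib)
  show ?case
    unfolding eq
    using tendsto_mult_left_zero[OF translation_L1_indicator[of A]] base by (simp add: fmeasurable_def)
next
  case (add f g)
  note T = integrable_aff[of 1, simplified]
  have fs: "integrable lebesgue (\<lambda>p. f (s + p))" and gs: "integrable lebesgue (\<lambda>p. g (s + p))" for s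
    using T add by blast+
  show ?case
  proof (rule Lim_null_comparison)
    show "((\<lambda>s. (LINT p|lebesgue. \<bar>f (s + p) - f p\<bar>) + (LINT p|lebesgue. \<bar>g (s + p) - g p\<bar>)) \<longlongrightarrow> 0) (at 0)"
      using tendsto_add[OF add(2,4)] by simp
    have "(LINT p|lebesgue. \<bar>f (s + p) + g (s + p) - (f p + g p)\<bar>)
      \<le> (LINT p|lebesgue. \<bar>f (s + p) - f p\<bar> + \<bar>g (s + p) - g p\<bar>)" for s
      by (rule integral_mono) (use add fs[of s] gs[of s] in \<open>auto intro!: Bochner_Integration.integrable_add integrable_abs Bochner_Integration.integrable_diff\<close>)
    then show "\<forall>\<^sub>F s in at 0. norm (LINT p|lebesgue. \<bar>f (s + p) + g (s + p) - (f p + g p)\<bar>)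
      \<le> (LINT p|lebesgue. \<bar>f (s + p) - f p\<bar>) + (LINT p|lebesgue. \<bar>g (s + p) - g p\<bar>)"
      using add fs gs by simp
  qed
next
  case (lim f S)
  have "(\<lambda>i. LINT p|lebesgue. \<bar>f p - S i p\<bar>) \<longlonglongrightarrow> (LINT p|(lebesgue :: (real \<times> real) measure). 0)"
  proof (rule integral_dominated_convergence[where w="\<lambda>p. 3 * norm (f p)"])
    show "AE p in lebesgue. (\<lambda>i. \<bar>f p - S i p\<bar>) \<longlonglongrightarrow> 0"
    proof (rule AE_I2)
      fix p :: "real \<times> real" assume "p \<in> space lebesgue"
      from tendsto_diff[OF tendsto_const lim(3)[OF this], of "f p"]
      show "(\<lambda>i. \<bar>f p - S i p\<bar>) \<longlonglongrightarrow> 0" by (intro tendsto_rabs_zero) simp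
    qed
    show "AE p in lebesgue. norm \<bar>f p - S i p\<bar> \<le> 3 * norm (f p)" for i
    proof (rule AE_I2)
      fix p :: "real \<times> real" assume "p \<in> space lebesgue"
      from lim(4)[OF this, of i] show "norm \<bar>f p - S i p\<bar> \<le> 3 * norm (f p)" by simp
    qed
  qed (use lim in auto)
  then have L: "(\<lambda>i. LINT p|lebesgue. \<bar>f p - S i p\<bar>) \<longlonglongrightarrow> 0" by simp
  show ?case
  proof (rule tendstoI)
    fix e :: real assume e: "e > 0"
    then obtain i where i: "(LINT p|lebesgue. \<bar>f p - S i p\<bar>) < e / 4"
      using order_tendstoD(2)[OF L, of "e / 4"] by (auto simp: eventually_sequentially)
    have "\<forall>\<^sub>F s in at 0. (LINT p|lebesgue. \<bar>S i (s + p) - S i p\<bar>) < e / 2"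
      using order_tendstoD(2)[OF lim(2)[of i], of "e / 2"] e by simp
    then show "\<forall>\<^sub>F s in at 0. dist (LINT p|lebesgue. \<bar>f (s + p) - f p\<bar>) 0 < e"
    proof eventually_elim
      case (elim s)
      then show ?case using translation_L1_perturb[OF lim(5) lim(1)[of i], of s] i by simp
    qed
  qed
qed

text \<open>
  Reduced to the case of integrable functions by passing from f to \<open>q = f \<bar>f\<bar>\<close>, which is integrable and
  satisfies \<open>(a - b)\<^sup>2 \<le> 2 \<bar>a \<bar>a\<bar> - b \<bar>b\<bar>\<bar>\<close> pointwise.
\<close>
lemma translation_L2_continuous:
  assumes f: "L2 f"
  shows "((\<lambda>s. LINT p|lebesgue. (f (s + p) - f p)\<^sup>2) \<longlongrightarrow> 0) (at 0)"
proof -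
  \<comment> \<open>Squaring alone would lose the sign of f, and with it the control of opposite values.\<close>
  define q where "q p = f p * \<bar>f p\<bar>" for p
  have q: "integrable lebesgue q"
    unfolding q_def
  proof (rule Bochner_Integration.integrable_bound[OF L2_integrable_square[OF f]])
    show "(\<lambda>p. f p * \<bar>f p\<bar>) \<in> borel_measurable lebesgue" using L2_measurable[OF f] by auto
  qed (simp add: abs_mult power2_eq_square)
  have le: "(a - b)\<^sup>2 \<le> 2 * \<bar>a * \<bar>a\<bar> - b * \<bar>b\<bar>\<bar>" for a b :: real
  proof -
    have pos: "(a - b)\<^sup>2 \<le> \<bar>a * a - b * b\<bar>" if "a \<ge> 0" "b \<ge> 0" for a b :: real
    proof -
      have "(a - b)\<^sup>2 = \<bar>a - b\<bar> * \<bar>a - b\<bar>" by (simp add: power2_eq_square)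
      also have "\<dots> \<le> \<bar>a - b\<bar> * \<bar>a + b\<bar>" using that by (intro mult_left_mono) auto
      also have "\<dots> = \<bar>a * a - b * b\<bar>" by (simp add: algebra_simps flip: abs_mult)
      finally show ?thesis .
    qed
    have dbl: "(a + b)\<^sup>2 \<le> 2 * (a * a + b * b)" for a b :: real
      using sum_squares_bound[of a b] by (simp add: power2_eq_square algebra_simps)
    consider "a \<ge> 0" "b \<ge> 0" | "a \<ge> 0" "b < 0" | "a < 0" "b \<ge> 0" | "a < 0" "b < 0" by linarith
    then show ?thesis
    proof cases
      case 1
      have "(a - b)\<^sup>2 \<le> 2 * \<bar>a * a - b * b\<bar>" by (rule order_trans[OF pos[OF 1]]) simp
      then show ?thesis using 1 by simp
    next
      case 2
      then show ?thesis using dbl[of a "-b"] by simp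
    next
      case 3
      then show ?thesis using dbl[of "-a" b] by (simp add: power2_commute)
    next
      case 4
      have "(a - b)\<^sup>2 \<le> \<bar>b * b - a * a\<bar>"
        using pos[of "-b" "-a"] 4 by simp
      also have "\<dots> \<le> 2 * \<bar>b * b - a * a\<bar>" by simp
      finally have "(a - b)\<^sup>2 \<le> 2 * \<bar>b * b - a * a\<bar>" .
      then show ?thesis using 4 by simp
    qed
  qed
  show ?thesis
  proof (rule Lim_null_comparison)
    show "((\<lambda>s. 2 * (LINT p|lebesgue. \<bar>q (s + p) - q p\<bar>)) \<longlongrightarrow> 0) (at 0)"
      using tendsto_mult_right_zero[OF translation_L1_continuous[OF q]] by simp
    have "(LINT p|lebesgue. (f (s + p) - f p)\<^sup>2) \<le> (LINT p|lebesgue. 2 * \<bar>q (s + p) - q p\<bar>)" for s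
    proof (rule integral_mono)
      show "integrable lebesgue (\<lambda>p. (f (s + p) - f p)\<^sup>2)"
        using L2_diff[OF L2_aff[of 1 f s] f] f by (simp add: L2_def)
      show "integrable lebesgue (\<lambda>p. 2 * \<bar>q (s + p) - q p\<bar>)"
        using integrable_aff[of 1 q s] q by simp
      show "(f (s + p) - f p)\<^sup>2 \<le> 2 * \<bar>q (s + p) - q p\<bar>" for p
        unfolding q_def by (rule le)
    qed
    then show "\<forall>\<^sub>F s in at 0. norm (LINT p|lebesgue. (f (s + p) - f p)\<^sup>2) \<le> 2 * (LINT p|lebesgue. \<bar>q (s + p) - q p\<bar>)"
      by simp
  qed
qed

lemma L2_tendsto_aff:
  assumes f: "L2 f" and \<sigma>: "\<bar>\<sigma>\<bar> = 1" and a: "(a \<longlongrightarrow> a0) F"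
  shows "L2_tendsto (\<lambda>i p. f (aff \<sigma> (a i) p)) (\<lambda>p. f (aff \<sigma> a0 p)) F"
proof -
  define g where "g s = (LINT p|lebesgue. (f (s + p) - f p)\<^sup>2)" for s
  have eq: "(LINT p|lebesgue. (f (aff \<sigma> (a i) p) - f (aff \<sigma> a0 p))\<^sup>2) = g (a i - a0)" for i
  proof -
    have "aff \<sigma> (a i) p = (a i - a0) + aff \<sigma> a0 p" for p by (simp add: aff_def)
    then show ?thesis
      unfolding g_def
      using integral_aff[OF \<sigma>, of "\<lambda>p. (f ((a i - a0) + p) - f p)\<^sup>2" a0]
        L2_measurable[OF L2_aff[of 1 f "a i - a0"]] L2_measurable[OF f] f by simp
  qed
  have "isCont g 0"
    using translation_L2_continuous[OF f] by (simp add: isCont_def g_def[abs_def])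
  from isCont_tendsto_compose[OF this, of "\<lambda>i. a i - a0" F] LIM_zero[OF a]
  have "((\<lambda>i. g (a i - a0)) \<longlongrightarrow> 0) F" by (simp add: g_def)
  then show ?thesis unfolding L2_tendsto_def eq .
qed

section \<open>Differentiation under the integral sign\<close>

text \<open>
  Differentiation under the integral sign when only the second factor is differentiable. On a
  compact range of parameters the difference quotients of \<open>\<Phi>\<close> are bounded by a constant on a
  fixed ball and vanish outside it, so dominated convergence applies. The support
  is only controlled locally in t: reflected test functions move to infinity with the axis.
\<close>
lemma has_real_derivative_integral_param:
  fixes \<Phi> :: "real \<times> real \<times> real \<Rightarrow> real"
  assumes f: "L2 f" and \<Phi>: "smooth \<Phi>"
    and supp: "\<And>r. \<exists>B. \<forall>t p. \<bar>t\<bar> \<le> r \<longrightarrow> norm p > B \<longrightarrow> \<Phi> (t, p) = 0"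
  shows "((\<lambda>t. LINT p|lebesgue. f p * \<Phi> (t, p)) has_real_derivative
    (LINT p|lebesgue. f p * dir_deriv (1, 0, 0) \<Phi> (t, p))) (at t)"
proof -
  let ?D = "dir_deriv (1, 0, 0) \<Phi>"
  define r where "r = \<bar>t\<bar> + 1"
  obtain B where B: "\<And>s p. \<bar>s\<bar> \<le> r \<Longrightarrow> norm p > B \<Longrightarrow> \<Phi> (s, p) = 0"
    using supp[of r] by blast
  have D: "((\<lambda>s. \<Phi> (s, p)) has_real_derivative ?D (s, p)) (at s within S)" for s p S
    using smooth_has_real_derivative_line[OF \<Phi>, of "(0, p)" "(1, 0, 0)" s S] by (cases p) (simp add: zero_prod_def)
  have "bounded (?D ` (cball 0 r \<times> cball 0 B))"
    by (intro compact_imp_bounded compact_continuous_image smooth_continuous smooth_dir_deriv \<Phi> compact_Times compact_cball)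
  then obtain C where C: "\<And>s p. \<bar>s\<bar> \<le> r \<Longrightarrow> norm p \<le> B \<Longrightarrow> \<bar>?D (s, p)\<bar> \<le> C"
    unfolding bounded_iff by fastforce
  have meas: "(\<lambda>p. h (s, p)) \<in> borel_measurable lebesgue" if "smooth h" for h :: "real \<times> real \<times> real \<Rightarrow> real" and s
    by (intro measurable_continuous_lebesgue continuous_on_compose2[OF smooth_continuous[OF that, of UNIV]] continuous_intros) auto
  note mf = L2_measurable[OF f]
  have bound: "\<bar>(\<Phi> (t + h, p) - \<Phi> (t, p)) / h\<bar> \<le> C * indicat_real (cball 0 B) p" if h: "h \<in> {-1..1} - {0}" for h p
  proof (cases "norm p \<le> B")
    case True
    have "\<bar>\<Phi> (t + h, p) - \<Phi> (t, p)\<bar> \<le> C * \<bar>(t + h) - t\<bar>"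
    proof (rule field_differentiable_bound[where S="cball 0 r" and f'="\<lambda>s. ?D (s, p)", simplified])
      show "((\<lambda>s. \<Phi> (s, p)) has_real_derivative ?D (s, p)) (at s within cball 0 r)" for s by (rule D)
    qed (use C True h in \<open>auto simp: r_def\<close>)
    then show ?thesis using True h by (simp add: field_simps)
  next
    case False
    then have "\<Phi> (t + h, p) = 0" "\<Phi> (t, p) = 0" using h by (auto intro!: B simp: r_def)
    then show ?thesis using False by simp
  qed
  have int: "integrable lebesgue (\<lambda>p. f p * \<Phi> (s, p))" if s: "\<bar>s\<bar> \<le> r" for s
  proof -
    have "bounded (\<Phi> ` (cball 0 r \<times> cball 0 B))"
      by (intro compact_imp_bounded compact_continuous_image smooth_continuous \<Phi> compact_Times compact_cball)
    then obtain M where M: "\<And>s p. \<bar>s\<bar> \<le> r \<Longrightarrow> norm p \<le> B \<Longrightarrow> \<bar>\<Phi> (s, p)\<bar> \<le> M"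
      unfolding bounded_iff by fastforce
    have "\<bar>\<Phi> (s, p)\<bar> \<le> \<bar>M\<bar>" for p
      using M[OF s, of p] B[OF s, of p] by (cases "norm p \<le> B") auto
    from L2_mult_bounded[OF L2_indicator meas[OF \<Phi>] this, of "cball 0 B"]
    have "L2 (\<lambda>p. indicat_real (cball 0 B) p * \<Phi> (s, p))" by simp
    moreover have "(\<lambda>p. indicat_real (cball 0 B) p * \<Phi> (s, p)) = (\<lambda>p. \<Phi> (s, p))"
    proof
      show "indicat_real (cball 0 B) p * \<Phi> (s, p) = \<Phi> (s, p)" for p
        using B[OF s, of p] by (cases "norm p \<le> B") auto
    qed
    ultimately show ?thesis using f by (simp add: integrable_mult_L2)
  qed
  have "((\<lambda>h. LINT p|lebesgue. f p * ((\<Phi> (t + h, p) - \<Phi> (t, p)) / h)) \<longlongrightarrow>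
      (LINT p|lebesgue. f p * ?D (t, p))) (at 0 within {-1..1})"
    unfolding tendsto_at_iff_sequentially o_def
  proof safe
    fix X :: "nat \<Rightarrow> real" assume X: "\<forall>i. X i \<in> {-1..1} - {0}" and lim: "X \<longlonglongrightarrow> 0"
    show "(\<lambda>i. LINT p|lebesgue. f p * ((\<Phi> (t + X i, p) - \<Phi> (t, p)) / X i)) \<longlonglongrightarrow> (LINT p|lebesgue. f p * ?D (t, p))"
    proof (rule integral_dominated_convergence[where w="\<lambda>p. C * (\<bar>f p\<bar> * indicat_real (cball 0 B) p)"])
      show "(\<lambda>p. f p * ?D (t, p)) \<in> borel_measurable lebesgue"
        using mf meas[OF smooth_dir_deriv[OF \<Phi>]] by auto
      show "(\<lambda>p. f p * ((\<Phi> (t + X i, p) - \<Phi> (t, p)) / X i)) \<in> borel_measurable lebesgue" for i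
        using mf meas[OF \<Phi>] by auto
      have "L2 (\<lambda>p. \<bar>f p\<bar>)" using f by (auto simp: L2_def)
      then show "integrable lebesgue (\<lambda>p. C * (\<bar>f p\<bar> * indicat_real (cball 0 B) p))"
        by (intro integrable_mult_right integrable_mult_L2 L2_indicator) auto
      have "(\<lambda>i. f p * ((\<Phi> (t + X i, p) - \<Phi> (t, p)) / X i)) \<longlonglongrightarrow> f p * ?D (t, p)" for p
      proof (rule tendsto_mult_left)
        have "((\<lambda>h. (\<Phi> (t + h, p) - \<Phi> (t, p)) / h) \<longlongrightarrow> ?D (t, p)) (at 0)"
          using D[of p t UNIV] by (simp add: DERIV_def)
        then show "(\<lambda>i. (\<Phi> (t + X i, p) - \<Phi> (t, p)) / X i) \<longlonglongrightarrow> ?D (t, p)"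
          unfolding tendsto_at_iff_sequentially o_def using X lim by blast
      qed
      then show "AE p in lebesgue. (\<lambda>i. f p * ((\<Phi> (t + X i, p) - \<Phi> (t, p)) / X i)) \<longlonglongrightarrow> f p * ?D (t, p)"
        by simp
      have "norm (f p * ((\<Phi> (t + X i, p) - \<Phi> (t, p)) / X i)) \<le> C * (\<bar>f p\<bar> * indicat_real (cball 0 B) p)" for i p
      proof -
        have "norm (f p * ((\<Phi> (t + X i, p) - \<Phi> (t, p)) / X i)) \<le> \<bar>f p\<bar> * (C * indicat_real (cball 0 B) p)"
          unfolding real_norm_def abs_mult[of "f p"] by (intro mult_left_mono bound) (use X in auto)
        then show ?thesis by (simp only: ac_simps)
      qed
      then show "AE p in lebesgue. norm (f p * ((\<Phi> (t + X i, p) - \<Phi> (t, p)) / X i)) \<le> C * (\<bar>f p\<bar> * indicat_real (cball 0 B) p)" for i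
        by simp
    qed
  qed
  moreover have "at 0 within {-1..1} = at (0::real)" by (rule at_within_interior) simp
  ultimately have "((\<lambda>h. LINT p|lebesgue. f p * ((\<Phi> (t + h, p) - \<Phi> (t, p)) / h)) \<longlongrightarrow>
      (LINT p|lebesgue. f p * ?D (t, p))) (at 0)" by simp
  then have "((\<lambda>h. ((LINT p|lebesgue. f p * \<Phi> (t + h, p)) - (LINT p|lebesgue. f p * \<Phi> (t, p))) / h) \<longlongrightarrow>
      (LINT p|lebesgue. f p * ?D (t, p))) (at 0)"
  proof (rule Lim_transform_eventually)
    \<comment> \<open>Within unit distance the support is controlled by the radius r chosen above.\<close>
    have "\<forall>\<^sub>F h in at (0::real). h \<in> {-1<..<1}"
      by (rule eventually_at_in_open') auto
    then show "\<forall>\<^sub>F h in at 0. (LINT p|lebesgue. f p * ((\<Phi> (t + h, p) - \<Phi> (t, p)) / h)) =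
        ((LINT p|lebesgue. f p * \<Phi> (t + h, p)) - (LINT p|lebesgue. f p * \<Phi> (t, p))) / h"
    proof eventually_elim
      case (elim h)
      have "integrable lebesgue (\<lambda>p. f p * \<Phi> (t + h, p))" "integrable lebesgue (\<lambda>p. f p * \<Phi> (t, p))"
        using elim by (auto intro!: int simp: r_def)
      then have "(LINT p|lebesgue. (f p * \<Phi> (t + h, p) - f p * \<Phi> (t, p)) / h) =
        ((LINT p|lebesgue. f p * \<Phi> (t + h, p)) - (LINT p|lebesgue. f p * \<Phi> (t, p))) / h" by simp
      moreover have "(f p * \<Phi> (t + h, p) - f p * \<Phi> (t, p)) / h = f p * ((\<Phi> (t + h, p) - \<Phi> (t, p)) / h)" for p
        by (simp add: algebra_simps diff_divide_distrib)
      ultimately show ?case by simp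
    qed
  qed
  then show ?thesis by (simp add: DERIV_def)
qed

section \<open>Uniqueness of weak derivatives\<close>

text \<open>
  A smooth bump carried by the rectangle with corners \<open>(a, a')\<close> and \<open>(b, b')\<close>; increasing c makes
  its edges steeper.
\<close>
lemma test_function_rectangle_bump:
  "test_function UNIV (\<lambda>p::real \<times> real. ramp (c * (fst p - a)) * ramp (c * (b - fst p)) *
     (ramp (c * (snd p - a')) * ramp (c * (b' - snd p))))" if c: "c > 0"
  for a b a' b' c :: real
proof (rule test_functionI[of _ "cbox (a, a') (b, b')"])
  let ?A = "\<lambda>p::real \<times> real. c * fst p" and ?B = "\<lambda>p::real \<times> real. c * snd p"
  have L: "bounded_linear ?A" "bounded_linear ?B"
    by (intro bounded_linear_intros bounded_linear_mult_right[THEN bounded_linear_compose])+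
  note L' = bounded_linear_minus[OF L(1)] bounded_linear_minus[OF L(2)]
  show "smooth (\<lambda>p::real \<times> real. ramp (c * (fst p - a)) * ramp (c * (b - fst p)) *
     (ramp (c * (snd p - a')) * ramp (c * (b' - snd p))))"
    using smooth_affine[OF smooth_ramp L(1), of "- c * a"] smooth_affine[OF smooth_ramp L(2), of "- c * a'"]
      smooth_affine[OF smooth_ramp L'(1), of "c * b"] smooth_affine[OF smooth_ramp L'(2), of "c * b'"]
    by (intro smooth_mult) (simp_all add: algebra_simps)
  show "ramp (c * (fst p - a)) * ramp (c * (b - fst p)) * (ramp (c * (snd p - a')) * ramp (c * (b' - snd p))) = 0"
    if "p \<notin> cbox (a, a') (b, b')" for p
  proof -
    have "fst p \<le> a \<or> b \<le> fst p \<or> snd p \<le> a' \<or> b' \<le> snd p"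
      using that by (cases p) (auto simp: not_le)
    then show ?thesis
      using c by (auto simp: ramp_zero mult_nonneg_nonpos)
  qed
qed auto

lemma integral_rectangle_eq_0:
  assumes g: "L2 g" and 0: "\<And>\<psi>. test_function UNIV \<psi> \<Longrightarrow> (LINT p|lebesgue. g p * \<psi> p) = 0"
  shows "(LINT p|lebesgue. g p * indicat_real (box l u) p) = 0"
proof -
  obtain a a' b b' where lu: "l = (a, a')" "u = (b, b')" by (cases l, cases u) auto
  define \<psi> where "\<psi> n p = ramp (real (Suc n) * (fst p - a)) * ramp (real (Suc n) * (b - fst p)) *
     (ramp (real (Suc n) * (snd p - a')) * ramp (real (Suc n) * (b' - snd p)))" for n and p :: "real \<times> real"
  have t: "test_function UNIV (\<psi> n)" for n
    unfolding \<psi>_def by (rule test_function_rectangle_bump) simp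
  have "(\<lambda>n. LINT p|lebesgue. g p * \<psi> n p) \<longlonglongrightarrow> (LINT p|lebesgue. g p * indicat_real (box l u) p)"
  proof (rule integral_dominated_convergence[where w="\<lambda>p. \<bar>g p\<bar> * indicat_real (cbox l u) p"])
    have "L2 (\<lambda>p. \<bar>g p\<bar>)" using g by (auto simp: L2_def)
    then show "integrable lebesgue (\<lambda>p. \<bar>g p\<bar> * indicat_real (cbox l u) p)"
      by (intro integrable_mult_L2 L2_indicator) auto
    show "(\<lambda>p. g p * indicat_real (box l u) p) \<in> borel_measurable lebesgue"
      by (intro borel_measurable_times borel_measurable_indicator L2_measurable g) auto
    show "(\<lambda>p. g p * \<psi> n p) \<in> borel_measurable lebesgue" for n
      using L2_measurable[OF g] test_function_measurable[OF t[of n]] by auto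
    have "(\<lambda>n. \<psi> n p) \<longlonglongrightarrow> indicat_real (box l u) p" for p
    proof -
      have "(\<lambda>n. \<psi> n p) \<longlonglongrightarrow> ((if fst p - a > 0 then 1 else 0) * (if b - fst p > 0 then 1 else 0) *
         ((if snd p - a' > 0 then 1 else 0) * (if b' - snd p > 0 then 1 else 0)))" (is "_ \<longlonglongrightarrow> ?L")
        unfolding \<psi>_def by (intro tendsto_mult LIMSEQ_Suc[OF ramp_scaled_tendsto])
      moreover have "?L = indicat_real (box l u) p"
        by (cases p) (auto simp: lu indicator_def mem_box Basis_prod_def)
      ultimately show ?thesis by simp
    qed
    then show "AE p in lebesgue. (\<lambda>n. g p * \<psi> n p) \<longlonglongrightarrow> g p * indicat_real (box l u) p"
      by (intro AE_I2 tendsto_mult_left)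
    have "\<bar>\<psi> n p\<bar> \<le> indicat_real (cbox l u) p" for n p
    proof (cases "p \<in> cbox l u")
      case True
      have "\<bar>\<psi> n p\<bar> \<le> 1 * 1 * (1 * 1)"
        unfolding \<psi>_def abs_mult
        by (intro mult_mono) (auto simp: ramp_nonneg ramp_le_1)
      then show ?thesis using True by simp
    next
      case False
      then have "fst p \<le> a \<or> b \<le> fst p \<or> snd p \<le> a' \<or> b' \<le> snd p"
        by (cases p) (auto simp: not_le lu)
      then have "\<psi> n p = 0"
        unfolding \<psi>_def by (auto simp: ramp_zero mult_nonneg_nonpos)
      then show ?thesis by simp
    qed
    then show "AE p in lebesgue. norm (g p * \<psi> n p) \<le> \<bar>g p\<bar> * indicat_real (cbox l u) p" for n
      by (intro AE_I2) (simp add: abs_mult mult_left_mono)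
  qed
  then show ?thesis
    by (simp add: 0[OF t] LIMSEQ_const_iff)
qed

text \<open>
  Integrals over rectangles vanish because rectangles are limits of bumps. Rectangles generate the
  Borel sets and are stable under intersection, so all integrals over Borel subsets of a large box vanish,
  and g is zero almost everywhere in that box.
\<close>
lemma fundamental_lemma_L2:
  assumes g: "L2 g" and 0: "\<And>\<psi>. test_function UNIV \<psi> \<Longrightarrow> (LINT p|lebesgue. g p * \<psi> p) = 0"
  shows "AE p in lebesgue. g p = 0"
proof -
  obtain g' where g': "g' \<in> borel_measurable lborel" "AE p in lborel. g p = g' p"
    using completion_ex_borel_measurable_real[OF L2_measurable[OF g]] by blast
  have m: "(\<lambda>p. g p * indicat_real (box l u) p) \<in> borel_measurable lebesgue"
    "(\<lambda>p. g' p * indicat_real (box l u) p) \<in> borel_measurable lebesgue" for l u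
    by (intro borel_measurable_times borel_measurable_indicator L2_measurable g measurable_completion g'(1); auto)+
  have eq: "(LINT p|lborel. g' p * indicat_real (box l u) p) = 0" for l u
  proof -
    have "(LINT p|lborel. g' p * indicat_real (box l u) p) = (LINT p|lebesgue. g' p * indicat_real (box l u) p)"
      using g'(1) by (intro integral_completion[symmetric]) auto
    also have "\<dots> = (LINT p|lebesgue. g p * indicat_real (box l u) p)"
      using AE_completion[OF g'(2)] by (intro integral_cong_AE m) auto
    also have "\<dots> = 0" by (rule integral_rectangle_eq_0[OF g 0])
    finally show ?thesis .
  qed
  have int: "integrable lborel (\<lambda>p. g' p * indicat_real (box l u) p)" for l u
  proof -
    have "integrable lebesgue (\<lambda>p. g p * indicat_real (box l u) p)"
      by (intro integrable_mult_L2 g L2_indicator) auto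
    then have "integrable lebesgue (\<lambda>p. g' p * indicat_real (box l u) p)"
      using AE_completion[OF g'(2)]
      by (subst integrable_cong_AE[OF m(2) m(1)]) auto
    then show ?thesis
      using g'(1) by (subst (asm) integrable_completion) auto
  qed
  have "AE p in lborel. g' p * indicat_real (box (- real n *\<^sub>R One) (real n *\<^sub>R One)) p = 0" for n
  proof (rule sigma_finite_measure.density_zero[OF sigma_finite_lborel int])
    let ?B = "box (- real n *\<^sub>R One) (real n *\<^sub>R One) :: (real \<times> real) set"
    let ?h = "\<lambda>p. g' p * indicat_real ?B p"
    let ?G = "range (\<lambda>(l, u). box l u) :: (real \<times> real) set set"
    have si: "set_integrable lborel A ?h" if "A \<in> sets borel" for A
      unfolding set_integrable_def by (rule integrable_mult_indicator) (use that int in auto)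
    fix A :: "(real \<times> real) set" assume "A \<in> sets lborel"
    then have "A \<in> sigma_sets UNIV ?G" by (simp add: borel_eq_box)
    have st: "Int_stable ?G" "?G \<subseteq> Pow UNIV" by (auto simp: Int_stable_def box_Int_box)
    from \<open>A \<in> sigma_sets UNIV ?G\<close> show "set_lebesgue_integral lborel A ?h = 0"
    proof (induction A rule: sigma_sets_induct_disjoint[OF st, consumes 1, case_names basic empty compl union])
      case (basic A)
      then obtain l u where A: "A = box l u" by auto
      obtain l' u' where lu: "A \<inter> ?B = box l' u'" unfolding A box_Int_box by blast
      then have "indicat_real A p *\<^sub>R ?h p = g' p * indicat_real (box l' u') p" for p
        unfolding lu[symmetric] by (simp add: indicator_inter_arith)
      then show ?case unfolding set_lebesgue_integral_def by (simp only: eq)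
    next
      case (compl A)
      then have A: "A \<in> sets borel" by (simp add: borel_eq_box)
      have "set_lebesgue_integral lborel UNIV ?h = set_lebesgue_integral lborel (A \<union> (UNIV - A)) ?h" by simp
      also have "\<dots> = set_lebesgue_integral lborel A ?h + set_lebesgue_integral lborel (UNIV - A) ?h"
        using A by (intro set_integral_Un si) auto
      finally show ?case using compl eq by (simp add: set_lebesgue_integral_def)
    next
      case (union A)
      then have A: "A i \<in> sets borel" for i by (auto simp: borel_eq_box)
      have "set_lebesgue_integral lborel (\<Union>i. A i) ?h = (\<Sum>i. set_lebesgue_integral lborel (A i) ?h)"
        using A union(1) by (intro lebesgue_integral_countable_add si) (auto simp: disjoint_family_on_def)
      then show ?case using union by simp
    qed (simp add: set_lebesgue_integral_def)
  qed
  then have "AE p in lborel. \<forall>n. g' p * indicat_real (box (- real n *\<^sub>R One) (real n *\<^sub>R One)) p = 0"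
    unfolding AE_all_countable by blast
  then have "AE p in lborel. g' p = 0"
  proof eventually_elim
    case (elim p)
    have "p \<in> (\<Union>n::nat. box (- (real n *\<^sub>R One)) (real n *\<^sub>R One))"
      unfolding UN_box_eq_UNIV by simp
    then obtain n where "p \<in> box (- real n *\<^sub>R One) (real n *\<^sub>R One)" by auto
    with elim[rule_format, of n] show ?case by simp
  qed
  with g'(2) have "AE p in lborel. g p = 0" by eventually_elim simp
  then show ?thesis by (rule AE_completion)
qed

lemma weak_deriv_unique:
  assumes "L2 g" "L2 h" "is_weak_deriv v f g" "is_weak_deriv v f h"
  shows "AE p in lebesgue. g p = h p"
proof -
  have "AE p in lebesgue. g p - h p = 0"
  proof (rule fundamental_lemma_L2[OF L2_diff[OF assms(1,2)]])
    fix \<psi> :: "real \<times> real \<Rightarrow> real" assume \<psi>: "test_function UNIV \<psi>"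
    have "(LINT p|lebesgue. g p * \<psi> p) = (LINT p|lebesgue. h p * \<psi> p)"
      using assms(3,4) \<psi> unfolding is_weak_deriv_def by fastforce
    moreover have "integrable lebesgue (\<lambda>p. g p * \<psi> p)" "integrable lebesgue (\<lambda>p. h p * \<psi> p)"
      using assms L2_test_function[OF \<psi>] by (auto intro: integrable_mult_L2)
    ultimately show "(LINT p|lebesgue. (g p - h p) * \<psi> p) = 0"
      by (simp add: left_diff_distrib)
  qed
  then show ?thesis by eventually_elim simp
qed

section \<open>The Sobolev space of order one\<close>

lemma H1_L2: "H1 f \<Longrightarrow> L2 f" by (simp add: H1_def)

lemma H1_weak_deriv:
  assumes "H1 f" "v \<in> {(1, 0), (0, 1)}"
  shows "L2 (weak_deriv v f)" "is_weak_deriv v f (weak_deriv v f)"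
proof -
  have "\<exists>g. L2 g \<and> is_weak_deriv v f g" using assms by (auto simp: H1_def)
  from someI_ex[OF this] show "L2 (weak_deriv v f)" "is_weak_deriv v f (weak_deriv v f)"
    by (auto simp: weak_deriv_def)
qed

text \<open>
  Makes the choice hidden in \<^const>\<open>weak_deriv\<close> harmless: any weak derivative that can be written
  down agrees with it almost everywhere.
\<close>
lemma AE_eq_weak_deriv:
  assumes "H1 f" "v \<in> {(1, 0), (0, 1)}" "L2 g" "is_weak_deriv v f g"
  shows "AE p in lebesgue. weak_deriv v f p = g p"
  using weak_deriv_unique H1_weak_deriv[OF assms(1,2)] assms(3,4) by blast

lemma is_weak_deriv_diff:
  assumes "L2 f" "L2 g" "L2 f'" "L2 g'" "is_weak_deriv v f f'" "is_weak_deriv v g g'"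
  shows "is_weak_deriv v (\<lambda>p. f p - g p) (\<lambda>p. f' p - g' p)"
  unfolding is_weak_deriv_def
proof safe
  fix \<psi> :: "real \<times> real \<Rightarrow> real" assume \<psi>: "test_function UNIV \<psi>"
  note L = L2_test_function[OF \<psi>] L2_test_function[OF test_function_dir_deriv[OF \<psi>, of v]]
  note I = integrable_mult_L2[OF assms(1) L(2)] integrable_mult_L2[OF assms(2) L(2)]
    integrable_mult_L2[OF assms(3) L(1)] integrable_mult_L2[OF assms(4) L(1)]
  show "(LINT p|lebesgue. (f p - g p) * dir_deriv v \<psi> p) = - (LINT p|lebesgue. (f' p - g' p) * \<psi> p)"
    using assms(5,6) \<psi> I by (simp add: is_weak_deriv_def left_diff_distrib)
qed

lemma H1_diff:
  assumes "H1 f" "H1 g" shows "H1 (\<lambda>p. f p - g p)"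
proof -
  have "\<exists>h. L2 h \<and> is_weak_deriv v (\<lambda>p. f p - g p) h" if v: "v \<in> {(1, 0), (0, 1)}" for v
  proof -
    note wf = H1_weak_deriv[OF assms(1) v] and wg = H1_weak_deriv[OF assms(2) v]
    show ?thesis
      using L2_diff[OF wf(1) wg(1)]
        is_weak_deriv_diff[OF H1_L2[OF assms(1)] H1_L2[OF assms(2)] wf(1) wg(1) wf(2) wg(2)] by blast
  qed
  then show ?thesis unfolding H1_def using L2_diff[OF H1_L2 H1_L2] assms by blast
qed

text \<open>
  The norm of a difference involves the chosen weak derivative of the difference; by uniqueness it
  may be replaced by the difference of the chosen weak derivatives.
\<close>
lemma H1_norm_diff:
  assumes f: "H1 f" and g: "H1 g"
  shows "(H1_norm (\<lambda>p. f p - g p))\<^sup>2 = (LINT p|lebesgue. (f p - g p)\<^sup>2)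
    + (LINT p|lebesgue. (weak_deriv (1, 0) f p - weak_deriv (1, 0) g p)\<^sup>2)
    + (LINT p|lebesgue. (weak_deriv (0, 1) f p - weak_deriv (0, 1) g p)\<^sup>2)"
proof -
  have "(LINT p|lebesgue. (weak_deriv v (\<lambda>p. f p - g p) p)\<^sup>2)
    = (LINT p|lebesgue. (weak_deriv v f p - weak_deriv v g p)\<^sup>2)" if v: "v \<in> {(1, 0), (0, 1)}" for v
  proof (rule integral_cong_AE)
    note wf = H1_weak_deriv[OF f v] and wg = H1_weak_deriv[OF g v]
    have D: "L2 (\<lambda>p. weak_deriv v f p - weak_deriv v g p)" by (intro L2_diff wf wg)
    from AE_eq_weak_deriv[OF H1_diff[OF f g] v D is_weak_deriv_diff[OF H1_L2[OF f] H1_L2[OF g] wf(1) wg(1) wf(2) wg(2)]]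
    show "AE p in lebesgue. (weak_deriv v (\<lambda>p. f p - g p) p)\<^sup>2 = (weak_deriv v f p - weak_deriv v g p)\<^sup>2"
      by eventually_elim simp
    show "(\<lambda>p. (weak_deriv v (\<lambda>p. f p - g p) p)\<^sup>2) \<in> borel_measurable lebesgue"
      by (intro borel_measurable_power L2_measurable H1_weak_deriv[OF H1_diff[OF f g] v])
    show "(\<lambda>p. (weak_deriv v f p - weak_deriv v g p)\<^sup>2) \<in> borel_measurable lebesgue"
      by (intro borel_measurable_power L2_measurable D)
  qed
  then show ?thesis by (simp add: H1_norm_def)
qed

lemma H1_norm_tendsto_iff:
  assumes f: "\<And>i. i \<in> S \<Longrightarrow> H1 (f i)" and g: "H1 g" and S: "\<forall>\<^sub>F i in F. i \<in> S"
  shows "((\<lambda>i. H1_norm (\<lambda>p. f i p - g p)) \<longlongrightarrow> 0) F \<longleftrightarrow>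
    L2_tendsto f g F \<and>
    L2_tendsto (\<lambda>i. weak_deriv (1, 0) (f i)) (weak_deriv (1, 0) g) F \<and>
    L2_tendsto (\<lambda>i. weak_deriv (0, 1) (f i)) (weak_deriv (0, 1) g) F" (is "?L \<longleftrightarrow> ?R")
proof
  define A B C where "A i = (LINT p|lebesgue. (f i p - g p)\<^sup>2)"
    and "B i = (LINT p|lebesgue. (weak_deriv (1, 0) (f i) p - weak_deriv (1, 0) g p)\<^sup>2)"
    and "C i = (LINT p|lebesgue. (weak_deriv (0, 1) (f i) p - weak_deriv (0, 1) g p)\<^sup>2)" for i
  have R: "?R \<longleftrightarrow> (A \<longlongrightarrow> 0) F \<and> (B \<longlongrightarrow> 0) F \<and> (C \<longlongrightarrow> 0) F"
    by (simp add: L2_tendsto_def A_def[abs_def] B_def[abs_def] C_def[abs_def])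
  have nn: "A i \<ge> 0" "B i \<ge> 0" "C i \<ge> 0" for i by (simp_all add: A_def B_def C_def)
  have eq: "\<forall>\<^sub>F i in F. A i + B i + C i = (H1_norm (\<lambda>p. f i p - g p))\<^sup>2"
    using S by eventually_elim (simp add: H1_norm_diff f g A_def B_def C_def)
  have eq': "\<forall>\<^sub>F i in F. sqrt (A i + B i + C i) = H1_norm (\<lambda>p. f i p - g p)"
    using eq by eventually_elim (simp add: H1_norm_def)
  show ?R if ?L
  proof -
    from tendsto_power[OF that, of 2] have "((\<lambda>i. (H1_norm (\<lambda>p. f i p - g p))\<^sup>2) \<longlongrightarrow> 0) F" by simp
    from Lim_transform_eventually[OF this eventually_mono[OF eq sym]]
    have sum: "((\<lambda>i. A i + B i + C i) \<longlongrightarrow> 0) F" .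
    have "(X \<longlongrightarrow> 0) F" if "\<And>i. 0 \<le> X i" "\<And>i. X i \<le> A i + B i + C i" for X
      by (rule tendsto_sandwich[OF _ _ tendsto_const sum]) (use that in auto)
    from this[of A] this[of B] this[of C] nn show ?R unfolding R by (simp add: add_increasing add_increasing2)
  qed
  show ?L if ?R
  proof -
    from that have "((\<lambda>i. sqrt (A i + B i + C i)) \<longlongrightarrow> sqrt (0 + 0 + 0)) F"
      unfolding R by (intro tendsto_intros) auto
    from Lim_transform_eventually[OF this eq'] show ?L by simp
  qed
qed

text \<open>
  The affine map is moved onto the test function by the change of variables with its inverse,
  whose linear part is the same because \<open>\<sigma>\<^sup>2 = 1\<close>.
\<close>
lemma is_weak_deriv_aff:
  assumes \<sigma>: "\<bar>\<sigma>\<bar> = 1" and f: "L2 f" "L2 f'" and w: "is_weak_deriv (a, b) f f'"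
  shows "is_weak_deriv (\<sigma> * a, b) (\<lambda>p. f (aff \<sigma> s p)) (\<lambda>p. f' (aff \<sigma> s p))"
  unfolding is_weak_deriv_def
proof safe
  fix \<psi> :: "real \<times> real \<Rightarrow> real" assume \<psi>: "test_function UNIV \<psi>"
  have \<sigma>\<sigma>: "\<sigma> * \<sigma> = 1" using \<sigma> by (metis abs_mult_self_eq mult_1)
  let ?A = "\<lambda>p::real \<times> real. (\<sigma> * fst p, snd p)"
  define s' where "s' = (- \<sigma> * fst s, - snd s)"
  define \<psi>' where "\<psi>' p = \<psi> (?A p + s')" for p
  have A: "linear ?A" by (intro linearI) (auto simp: algebra_simps)
  have inj: "inj ?A" using \<sigma> by (auto simp: inj_def prod_eq_iff)
  have t': "test_function UNIV \<psi>'"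
    unfolding \<psi>'_def[abs_def] by (rule test_function_affine[OF \<psi> A inj])
  have inv: "?A (aff \<sigma> s p) + s' = p" for p
    by (cases p) (simp add: aff_def s'_def algebra_simps \<sigma>\<sigma> prod_eq_iff flip: mult.assoc)
  have d: "dir_deriv (a, b) \<psi>' q = dir_deriv (\<sigma> * a, b) \<psi> (?A q + s')" for q
    unfolding \<psi>'_def[abs_def]
    by (subst dir_deriv_affine) (use A \<psi> in \<open>auto simp: linear_conv_bounded_linear
        intro!: smooth_differentiable test_function_smooth\<close>)
  have "(LINT p|lebesgue. f (aff \<sigma> s p) * dir_deriv (\<sigma> * a, b) \<psi> p)
    = (LINT p|lebesgue. f (aff \<sigma> s p) * dir_deriv (a, b) \<psi>' (aff \<sigma> s p))"
    by (simp only: d inv)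
  also have "\<dots> = (LINT p|lebesgue. f p * dir_deriv (a, b) \<psi>' p)"
    by (rule integral_aff[OF \<sigma>, of "\<lambda>p. f p * dir_deriv (a, b) \<psi>' p"])
       (intro borel_measurable_times L2_measurable[OF f(1)] test_function_measurable[OF test_function_dir_deriv[OF t']])
  also have "\<dots> = - (LINT p|lebesgue. f' p * \<psi>' p)"
    using w t' by (simp add: is_weak_deriv_def)
  also have "(LINT p|lebesgue. f' p * \<psi>' p) = (LINT p|lebesgue. f' (aff \<sigma> s p) * \<psi>' (aff \<sigma> s p))"
    by (rule integral_aff[OF \<sigma>, of "\<lambda>p. f' p * \<psi>' p", symmetric])
       (intro borel_measurable_times L2_measurable[OF f(2)] test_function_measurable[OF t'])
  also have "\<dots> = (LINT p|lebesgue. f' (aff \<sigma> s p) * \<psi> p)"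
    by (simp only: \<psi>'_def inv)
  finally show "(LINT p|lebesgue. f (aff \<sigma> s p) * dir_deriv (\<sigma> * a, b) \<psi> p) =
     - (LINT p|lebesgue. f' (aff \<sigma> s p) * \<psi> p)" .
qed

lemma is_weak_deriv_uminus:
  assumes "is_weak_deriv v f f'" shows "is_weak_deriv (- v) f (\<lambda>p. - f' p)"
  unfolding is_weak_deriv_def
proof safe
  fix \<psi> :: "real \<times> real \<Rightarrow> real" assume \<psi>: "test_function UNIV \<psi>"
  have "dir_deriv (- v) \<psi> p = - dir_deriv v \<psi> p" for p
    using smooth_dir_deriv_comb[OF test_function_smooth[OF \<psi>], of "-1" v 0 v p] by simp
  then show "(LINT p|lebesgue. f p * dir_deriv (- v) \<psi> p) = - (LINT p|lebesgue. - f' p * \<psi> p)"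
    using assms \<psi> by (simp add: is_weak_deriv_def)
qed

lemma
  assumes \<sigma>: "\<bar>\<sigma>\<bar> = 1" and f: "H1 f"
  shows H1_aff: "H1 (\<lambda>p. f (aff \<sigma> s p))"
    and weak_deriv_x_aff: "AE p in lebesgue. weak_deriv (1, 0) (\<lambda>p. f (aff \<sigma> s p)) p = \<sigma> * weak_deriv (1, 0) f (aff \<sigma> s p)"
    and weak_deriv_y_aff: "AE p in lebesgue. weak_deriv (0, 1) (\<lambda>p. f (aff \<sigma> s p)) p = weak_deriv (0, 1) f (aff \<sigma> s p)"
proof -
  note wx = H1_weak_deriv[OF f, of "(1, 0)", simplified] and wy = H1_weak_deriv[OF f, of "(0, 1)", simplified]
  have x: "is_weak_deriv (1, 0) (\<lambda>p. f (aff \<sigma> s p)) (\<lambda>p. \<sigma> * weak_deriv (1, 0) f (aff \<sigma> s p))"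
    using is_weak_deriv_aff[OF \<sigma> H1_L2[OF f] wx, of s] is_weak_deriv_uminus[OF is_weak_deriv_aff[OF \<sigma> H1_L2[OF f] wx, of s]] \<sigma>
    by (cases "\<sigma> = 1") (auto simp: abs_if split: if_splits)
  have y: "is_weak_deriv (0, 1) (\<lambda>p. f (aff \<sigma> s p)) (\<lambda>p. weak_deriv (0, 1) f (aff \<sigma> s p))"
    using is_weak_deriv_aff[OF \<sigma> H1_L2[OF f] wy, of s] by simp
  have L: "L2 (\<lambda>p. \<sigma> * weak_deriv (1, 0) f (aff \<sigma> s p))" "L2 (\<lambda>p. weak_deriv (0, 1) f (aff \<sigma> s p))"
    by (intro L2_cmult L2_aff \<sigma> wx wy)+
  show H: "H1 (\<lambda>p. f (aff \<sigma> s p))"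
    unfolding H1_def using x y L L2_aff[OF \<sigma> H1_L2[OF f]] by blast
  show "AE p in lebesgue. weak_deriv (1, 0) (\<lambda>p. f (aff \<sigma> s p)) p = \<sigma> * weak_deriv (1, 0) f (aff \<sigma> s p)"
    by (rule AE_eq_weak_deriv[OF H _ L(1) x]) simp
  show "AE p in lebesgue. weak_deriv (0, 1) (\<lambda>p. f (aff \<sigma> s p)) p = weak_deriv (0, 1) f (aff \<sigma> s p)"
    by (rule AE_eq_weak_deriv[OF H _ L(2) y]) simp
qed

lemma AE_eq_H1_weak_deriv:
  assumes f: "H1 f" and g: "H1 g" and eq: "AE p in lebesgue. f p = g p" and v: "v \<in> {(1, 0), (0, 1)}"
  shows "AE p in lebesgue. weak_deriv v f p = weak_deriv v g p"
proof (rule AE_eq_weak_deriv[OF f v H1_weak_deriv(1)[OF g v]])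
  show "is_weak_deriv v f (weak_deriv v g)"
    unfolding is_weak_deriv_def
  proof safe
    fix \<psi> :: "real \<times> real \<Rightarrow> real" assume \<psi>: "test_function UNIV \<psi>"
    have "(LINT p|lebesgue. f p * dir_deriv v \<psi> p) = (LINT p|lebesgue. g p * dir_deriv v \<psi> p)"
      using eq by (intro integral_cong_AE borel_measurable_times L2_measurable[OF H1_L2[OF f]]
        L2_measurable[OF H1_L2[OF g]] test_function_measurable[OF test_function_dir_deriv[OF \<psi>]]) auto
    also have "\<dots> = - (LINT p|lebesgue. weak_deriv v g p * \<psi> p)"
      using H1_weak_deriv(2)[OF g v] \<psi> by (simp add: is_weak_deriv_def)
    finally show "(LINT p|lebesgue. f p * dir_deriv v \<psi> p) = - (LINT p|lebesgue. weak_deriv v g p * \<psi> p)" .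
  qed
qed

section \<open>Weak derivatives in time\<close>

lemma smooth_antiderivative_exists:
  assumes "smooth k"
  obtains S :: "real \<Rightarrow> real" where "\<And>x. (S has_real_derivative k x) (at x)" "smooth S"
proof -
  have "isCont k x" for x
    using smooth_continuous[OF assms, of UNIV] by (simp add: continuous_on_eq_continuous_at)
  with einterval_antiderivative[of "-\<infinity>" \<infinity> k]
  obtain S where "\<And>x. (S has_vector_derivative k x) (at x)" by auto
  then have "\<And>x. (S has_real_derivative k x) (at x)"
    by (simp add: has_real_derivative_iff_has_vector_derivative)
  then show ?thesis using that smooth_antiderivative assms by blast
qed

text \<open>
  The temporal factors of tensor test functions. The derivative is carried along because both
  functions occur in the weak formulation.
\<close>
definition bump_with_derivative :: "real \<Rightarrow> (real \<Rightarrow> real) \<Rightarrow> (real \<Rightarrow> real) \<Rightarrow> bool" where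
  "bump_with_derivative T \<rho> \<rho>' \<longleftrightarrow> smooth \<rho> \<and> smooth \<rho>' \<and> (\<forall>x. (\<rho> has_real_derivative \<rho>' x) (at x)) \<and>
     (\<exists>a b. 0 < a \<and> b < T \<and> (\<forall>x. x \<notin> {a..b} \<longrightarrow> \<rho> x = 0))"

text \<open>
  If F were smaller at a than at b, take \<open>\<rho>\<close> rising from 0 to a plateau near a and falling back near
  b, so that \<open>\<rho>'\<close> is a positive bump at a minus the same bump at b. With a value m strictly between,
  \<open>\<rho>' (m - F)\<close> is nonnegative, positive at a, and has integral 0, which is impossible.
\<close>
lemma antitone_if_integral_against_bumps_eq_0:
  fixes F :: "real \<Rightarrow> real"
  assumes F: "continuous_on {0..T} F"
    and 0: "\<And>\<rho> \<rho>'. bump_with_derivative T \<rho> \<rho>' \<Longrightarrow> integral {0..T} (\<lambda>t. \<rho>' t * F t) = 0"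
    and ab: "0 < a" "a < b" "b < T"
  shows "F b \<le> F a"
proof (rule ccontr)
  assume "\<not> F b \<le> F a"
  define m where "m = (F a + F b) / 2"
  have m: "F a < m" "m < F b" using \<open>\<not> F b \<le> F a\<close> by (auto simp: m_def)
  have "isCont F a" "isCont F b"
    using continuous_on_interior[OF F] ab by auto
  then have "\<forall>\<^sub>F x in nhds a. F x < m" "\<forall>\<^sub>F x in nhds b. m < F x"
    using m by (auto simp: isCont_def tendsto_at_iff_tendsto_nhds intro: order_tendstoD)
  then obtain d1 d2 where d: "d1 > 0" "\<And>x. \<bar>x - a\<bar> < d1 \<Longrightarrow> F x < m" "d2 > 0" "\<And>x. \<bar>x - b\<bar> < d2 \<Longrightarrow> m < F x"
    unfolding eventually_nhds_metric dist_real_def by metis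
  \<comment> \<open>Small enough for both neighbourhoods and for the support of the bumps to stay inside the open interval.\<close>
  define e where "e = Min {d1, d2, a / 2, (T - b) / 2}"
  have e: "e > 0" "e \<le> d1" "e \<le> d2" "e < a" "e < T - b"
    using d ab by (auto simp: e_def min_def)
  define k where "k x = ramp (x + e) * ramp (e - x)" for x
  have k: "smooth k"
    unfolding k_def[abs_def]
    using smooth_affine[OF smooth_ramp bounded_linear_ident, of e]
      smooth_affine[OF smooth_ramp bounded_linear_minus[OF bounded_linear_ident], of e]
    by (intro smooth_mult) (simp_all add: algebra_simps)
  have k0: "k x = 0" if "\<not> \<bar>x\<bar> < e" for x
    using that by (auto simp: k_def ramp_zero abs_if split: if_splits)
  have kp: "k x \<ge> 0" for x by (simp add: k_def ramp_nonneg)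
  have k00: "k 0 > 0" using e by (simp add: k_def ramp_pos)
  obtain S where S: "\<And>x. (S has_real_derivative k x) (at x)" "smooth S"
    using smooth_antiderivative_exists[OF k] by blast
  have const: "S x = S y" if "x \<in> X" "y \<in> X" "X = {..-e} \<or> X = {e..}" for x y X
  proof (rule has_field_derivative_zero_constant[of X S, THEN exE])
    show "convex X" using that by auto
    show "(S has_real_derivative 0) (at z within X)" if "z \<in> X" for z
      using S(1)[of z] k0[of z] that \<open>X = {..-e} \<or> X = {e..}\<close> by (auto intro: has_field_derivative_at_within)
  qed (use that in auto)
  define \<rho> \<rho>' where "\<rho> t = S (t - a) - S (t - b)" and "\<rho>' t = k (t - a) - k (t - b)" for t
  have shift: "smooth (\<lambda>t. h (t - c))" if "smooth h" for h :: "real \<Rightarrow> real" and c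
    using smooth_affine[OF that bounded_linear_ident, of "-c"] by simp
  have d\<rho>: "(\<rho> has_real_derivative \<rho>' x) (at x)" for x
    unfolding \<rho>_def[abs_def] \<rho>'_def
    by (auto intro!: derivative_eq_intros DERIV_chain2[OF S(1)])
  have s0: "\<rho> x = 0" if "x \<notin> {a - e..b + e}" for x
  proof -
    have "x - a \<in> {..-e} \<and> x - b \<in> {..-e} \<or> x - a \<in> {e..} \<and> x - b \<in> {e..}"
      using that ab e by auto
    then have "S (x - a) = S (x - b)"
      using const[of "x - a" "{..-e}" "x - b"] const[of "x - a" "{e..}" "x - b"] by blast
    then show ?thesis by (simp add: \<rho>_def)
  qed
  have B: "bump_with_derivative T \<rho> \<rho>'"
    unfolding bump_with_derivative_def
  proof (intro conjI allI exI)
    show "smooth \<rho>" "smooth \<rho>'"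
      unfolding \<rho>_def[abs_def] \<rho>'_def[abs_def] by (intro smooth_diff shift S k)+
    show "0 < a - e" "b + e < T" using e by auto
  qed (use d\<rho> s0 in auto)
  have c': "continuous_on {0..T} \<rho>'"
    using B by (auto simp: bump_with_derivative_def intro: smooth_continuous)
  have "(\<rho>' has_integral (\<rho> T - \<rho> 0)) {0..T}"
    by (rule fundamental_theorem_of_calculus)
       (use ab in \<open>auto intro!: has_field_derivative_at_within[OF d\<rho>] simp flip: has_real_derivative_iff_has_vector_derivative\<close>)
  moreover have "\<rho> T = 0" "\<rho> 0 = 0" using e by (auto intro!: s0)
  ultimately have "(\<rho>' has_integral 0) {0..T}" by simp
  then have i1: "((\<lambda>t. \<rho>' t * m) has_integral 0) {0..T}"
    using has_integral_mult_left[of \<rho>' 0 "{0..T}" m] by simp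
  have "(\<lambda>t. \<rho>' t * F t) integrable_on {0..T}"
    by (intro integrable_continuous_real continuous_intros c' F)
  then have i2: "((\<lambda>t. \<rho>' t * F t) has_integral 0) {0..T}"
    using 0[OF B] by (simp add: has_integral_integral)
  have "integral {0..T} (\<lambda>t. \<rho>' t * (m - F t)) = 0"
    using has_integral_diff[OF i1 i2] by (simp add: integral_unique right_diff_distrib)
  moreover have "0 \<le> \<rho>' t * (m - F t)" for t
  proof -
    have "0 \<le> k (t - a) * (m - F t)"
      using kp[of "t - a"] d(2)[of t] e(2) k0[of "t - a"] by (cases "\<bar>t - a\<bar> < e") auto
    moreover have "0 \<le> k (t - b) * (F t - m)"
      using kp[of "t - b"] d(4)[of t] e(3) k0[of "t - b"] by (cases "\<bar>t - b\<bar> < e") auto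
    ultimately show ?thesis by (simp add: \<rho>'_def algebra_simps)
  qed
  moreover have "continuous_on {0..T} (\<lambda>t. \<rho>' t * (m - F t))"
    by (intro continuous_intros c' F)
  ultimately have "\<rho>' a * (m - F a) = 0"
    using integral_eq_0_iff[of 0 T "\<lambda>t. \<rho>' t * (m - F t)"] ab by auto
  moreover have "k (a - b) = 0"
    using k0[of "a - b"] d(4)[of a] e(3) m by force
  ultimately show False using m k00 by (simp add: \<rho>'_def)
qed

text \<open>
  Integration by parts turns the hypothesis into one on the difference of f and a primitive of g;
  that difference is both increasing and decreasing by the previous lemma.
\<close>
lemma du_Bois_Reymond:
  fixes f g :: "real \<Rightarrow> real"
  assumes f: "continuous_on {0..T} f" and g: "continuous_on {0..T} g"
    and 0: "\<And>\<rho> \<rho>'. bump_with_derivative T \<rho> \<rho>' \<Longrightarrow> integral {0..T} (\<lambda>t. \<rho>' t * f t + \<rho> t * g t) = 0"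
    and t: "t \<in> {0<..<T}"
  shows "(f has_real_derivative g t) (at t)"
proof -
  define G where "G t = integral {0..t} g" for t
  have G: "(G has_real_derivative g x) (at x within {0..T})" if "x \<in> {0..T}" for x
    unfolding G_def using integral_has_real_derivative[OF g that] .
  have cG: "continuous_on {0..T} G"
    using DERIV_continuous[OF G] unfolding continuous_on_eq_continuous_within by blast
  have z: "integral {0..T} (\<lambda>t. \<rho>' t * (f t - G t)) = 0" if B: "bump_with_derivative T \<rho> \<rho>'" for \<rho> \<rho>'
  proof -
    from B have r: "\<And>x. (\<rho> has_real_derivative \<rho>' x) (at x)" "continuous_on {0..T} \<rho>" "continuous_on {0..T} \<rho>'"
      "\<rho> 0 = 0" "\<rho> T = 0"
      by (auto simp: bump_with_derivative_def intro: smooth_continuous)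
    have "((\<lambda>t. \<rho>' t * G t + \<rho> t * g t) has_integral (\<rho> T * G T - \<rho> 0 * G 0)) {0..T}"
    proof (rule fundamental_theorem_of_calculus)
      \<comment> \<open>The primitive of the integrand is \<open>\<rho> * G\<close>, which vanishes at both ends.\<close>
      show "((\<lambda>t. \<rho> t * G t) has_vector_derivative \<rho>' x * G x + \<rho> x * g x) (at x within {0..T})" if "x \<in> {0..T}" for x
        unfolding has_real_derivative_iff_has_vector_derivative[symmetric]
        using DERIV_mult[OF has_field_derivative_at_within[OF r(1)] G[OF that]] by (simp add: mult.commute add.commute)
    qed (use t in auto)
    then have i1: "((\<lambda>t. \<rho>' t * G t + \<rho> t * g t) has_integral 0) {0..T}" using r by simp
    have "(\<lambda>t. \<rho>' t * f t + \<rho> t * g t) integrable_on {0..T}"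
      by (intro integrable_continuous_real continuous_intros r f g)
    then have i2: "((\<lambda>t. \<rho>' t * f t + \<rho> t * g t) has_integral 0) {0..T}"
      using 0[OF B] by (simp add: has_integral_integral)
    from has_integral_diff[OF i2 i1] show ?thesis
      by (simp add: integral_unique algebra_simps)
  qed
  have le: "f b - G b \<le> f a - G a" if "0 < a" "a < b" "b < T" for a b
    by (rule antitone_if_integral_against_bumps_eq_0[of T "\<lambda>t. f t - G t"])
       (use that z in \<open>auto intro!: continuous_intros f cG\<close>)
  have ge: "- (f b - G b) \<le> - (f a - G a)" if "0 < a" "a < b" "b < T" for a b
  proof (rule antitone_if_integral_against_bumps_eq_0[of T "\<lambda>t. - (f t - G t)"])
    show "integral {0..T} (\<lambda>t. \<rho>' t * - (f t - G t)) = 0" if "bump_with_derivative T \<rho> \<rho>'" for \<rho> \<rho>'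
      using z[OF that] by (simp only: mult_minus_right integral_neg minus_zero)
  qed (use that in \<open>auto intro!: continuous_intros f cG\<close>)
  have const: "f s = G s + (f t - G t)" if "s \<in> {0<..<T}" for s
    using le[of s t] ge[of s t] le[of t s] ge[of t s] that t by (cases s t rule: linorder_cases) auto
  have "(G has_real_derivative g t) (at t)"
    using G[of t] t at_within_interior[of t "{0..T}"] by auto
  then have "((\<lambda>s. G s + (f t - G t)) has_real_derivative g t) (at t)"
    by (auto intro!: derivative_eq_intros)
  then show ?thesis
    by (rule has_field_derivative_transform_within_open[OF _ open_greaterThanLessThan t]) (rule const[symmetric])
qed

lemma test_function_tensor:
  fixes \<psi> :: "real \<times> real \<Rightarrow> real"
  assumes \<rho>: "bump_with_derivative T \<rho> \<rho>'" and \<psi>: "test_function UNIV \<psi>"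
  shows "test_function ({0<..<T} \<times> UNIV) (\<lambda>q. \<rho> (fst q) * \<psi> (snd q))"
proof -
  from \<rho> obtain a b where ab: "0 < a" "b < T" "\<And>x. x \<notin> {a..b} \<Longrightarrow> \<rho> x = 0" and s: "smooth \<rho>"
    unfolding bump_with_derivative_def by blast
  from \<psi> obtain K where K: "compact K" "\<And>p. p \<notin> K \<Longrightarrow> \<psi> p = 0" and s': "smooth \<psi>"
    unfolding test_function_iff by blast
  show ?thesis
  proof (rule test_functionI[of _ "{a..b} \<times> K"])
    show "smooth (\<lambda>q. \<rho> (fst q) * \<psi> (snd q))"
      using smooth_affine[OF s bounded_linear_fst, of 0] smooth_affine[OF s' bounded_linear_snd, of 0]
      by (intro smooth_mult) simp_all
    show "\<rho> (fst q) * \<psi> (snd q) = 0" if "q \<notin> {a..b} \<times> K" for q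
      using that ab(3)[of "fst q"] K(2)[of "snd q"] by (auto simp: mem_Times_iff)
  qed (use ab K in \<open>auto intro!: compact_Times\<close>)
qed

section \<open>The weak formulation at a fixed time\<close>

abbreviation dx :: "(real \<times> real \<Rightarrow> real) \<Rightarrow> real \<times> real \<Rightarrow> real" where "dx \<equiv> dir_deriv (1, 0)"
abbreviation dy :: "(real \<times> real \<Rightarrow> real) \<Rightarrow> real \<times> real \<Rightarrow> real" where "dy \<equiv> dir_deriv (0, 1)"

definition Lx :: "(real \<times> real \<Rightarrow> real) \<Rightarrow> real \<times> real \<Rightarrow> real" where
  "Lx \<psi> = dx (\<lambda>p. \<psi> p - dx (dx \<psi>) p)"

text \<open>
  The weak formulation at a fixed time is the sum of two pairings: \<open>mass_form\<close> collects the term that meets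
  the time derivative of the test function, \<open>flux_form\<close> all the others.
\<close>
definition mass_form :: "(real \<times> real \<Rightarrow> real) \<Rightarrow> (real \<times> real \<Rightarrow> real) \<Rightarrow> real" where
  "mass_form f \<psi> = (LINT p|lebesgue. f p * Lx \<psi> p)"

definition flux_form :: "real \<Rightarrow> real \<Rightarrow> real \<Rightarrow> (real \<times> real \<Rightarrow> real) \<Rightarrow> (real \<times> real \<Rightarrow> real) \<Rightarrow> real" where
  "flux_form \<alpha> \<beta> \<gamma> f \<psi> = (LINT p|lebesgue.
       (3 / 2 * (f p)\<^sup>2 + \<gamma> / 2 * (weak_deriv (1, 0) f p)\<^sup>2) * dx (dx \<psi>) p
     - \<gamma> / 2 * (f p)\<^sup>2 * dx (dx (dx (dx \<psi>))) p
     - \<alpha> * f p * dy (dy \<psi>) p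
     + \<beta> * f p * dx (dx (dy (dy \<psi>))) p)"

lemma test_function_Lx: "test_function U \<psi> \<Longrightarrow> test_function U (Lx \<psi>)"
  unfolding Lx_def by (intro test_function_dir_deriv test_function_diff)

lemma slice_dir_deriv:
  assumes "smooth \<phi>"
  shows "(\<lambda>p. dir_deriv (0, v) \<phi> (t, p)) = dir_deriv v (\<lambda>p. \<phi> (t, p))"
proof
  fix p
  have "bounded_linear (\<lambda>p. (0, p) :: 'a \<times> 'b)"
    by (intro bounded_linear_Pair bounded_linear_zero bounded_linear_ident)
  from dir_deriv_affine[OF this, of \<phi> p "(t, 0)" v] smooth_differentiable[OF assms]
  show "dir_deriv (0, v) \<phi> (t, p) = dir_deriv v (\<lambda>p. \<phi> (t, p)) p" by simp
qed

lemma test_function_slice: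
  fixes \<phi> :: "real \<times> real \<times> real \<Rightarrow> real"
  assumes "test_function UNIV \<phi>" shows "test_function UNIV (\<lambda>p. \<phi> (t, p))"
  using test_function_affine[OF assms, of "\<lambda>p. (0, p)" "(t, 0)"]
  by (simp add: linear_conv_bounded_linear bounded_linear_Pair bounded_linear_zero bounded_linear_ident inj_def)

lemma slice_dir_deriv_apply:
  "smooth \<phi> \<Longrightarrow> dir_deriv (0, v) \<phi> (t, p) = dir_deriv v (\<lambda>p. \<phi> (t, p)) p"
  using fun_cong[OF slice_dir_deriv[of \<phi> v t], of p] .

lemma slice_L_op:
  assumes \<phi>: "smooth \<phi>"
  shows "L_op \<phi> (t, p) = Lx (\<lambda>p. \<phi> (t, p)) p"
  unfolding L_op_def Lx_def
  by (simp add: slice_dir_deriv_apply smooth_diff smooth_dir_deriv \<phi>)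

text \<open>
  Grouped into pairings of the kind covered by \<open>L2_tendsto_inner\<close>: one for the square of f, one for
  the square of its weak x-derivative, and one for the linear terms.
\<close>
lemma flux_form_eq:
  assumes f: "H1 f" and \<psi>: "test_function UNIV \<psi>"
  shows "flux_form \<alpha> \<beta> \<gamma> f \<psi> =
      (LINT p|lebesgue. f p * (f p * (3 / 2 * dx (dx \<psi>) p - \<gamma> / 2 * dx (dx (dx (dx \<psi>))) p)))
    + (LINT p|lebesgue. weak_deriv (1, 0) f p * (weak_deriv (1, 0) f p * (\<gamma> / 2 * dx (dx \<psi>) p)))
    + (LINT p|lebesgue. f p * (\<beta> * dx (dx (dy (dy \<psi>))) p - \<alpha> * dy (dy \<psi>) p))" (is "_ = ?A + ?B + ?C")
    and integrable_flux_form: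
    "integrable lebesgue (\<lambda>p. (3 / 2 * (f p)\<^sup>2 + \<gamma> / 2 * (weak_deriv (1, 0) f p)\<^sup>2) * dx (dx \<psi>) p
     - \<gamma> / 2 * (f p)\<^sup>2 * dx (dx (dx (dx \<psi>))) p
     - \<alpha> * f p * dy (dy \<psi>) p
     + \<beta> * f p * dx (dx (dy (dy \<psi>))) p)" (is "integrable _ ?F")
proof -
  note t = test_function_dir_deriv[where U=UNIV]
  let ?a = "\<lambda>p. 3 / 2 * dx (dx \<psi>) p - \<gamma> / 2 * dx (dx (dx (dx \<psi>))) p"
  let ?b = "\<lambda>p. \<gamma> / 2 * dx (dx \<psi>) p"
  let ?c = "\<lambda>p. \<beta> * dx (dx (dy (dy \<psi>))) p - \<alpha> * dy (dy \<psi>) p"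
  note w = H1_weak_deriv(1)[OF f, of "(1, 0)", simplified]
  have h: "test_function UNIV ?a" "test_function UNIV ?b" "test_function UNIV ?c"
    by (intro test_function_diff test_function_cmult t \<psi>)+
  have I: "integrable lebesgue (\<lambda>p. f p * (f p * ?a p))"
     "integrable lebesgue (\<lambda>p. weak_deriv (1, 0) f p * (weak_deriv (1, 0) f p * ?b p))"
     "integrable lebesgue (\<lambda>p. f p * ?c p)"
    by (intro integrable_mult_L2 L2_mult_test[OF _ h(1)] L2_mult_test[OF _ h(2)] L2_test_function[OF h(3)] H1_L2[OF f] w)+
  have eq: "?F = (\<lambda>p. f p * (f p * ?a p) + weak_deriv (1, 0) f p * (weak_deriv (1, 0) f p * ?b p) + f p * ?c p)"
    by (rule ext) (simp add: power2_eq_square algebra_simps)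
  show "integrable lebesgue ?F"
    unfolding eq by (intro Bochner_Integration.integrable_add I)
  show "flux_form \<alpha> \<beta> \<gamma> f \<psi> = ?A + ?B + ?C"
    unfolding flux_form_def eq using I by (simp only: Bochner_Integration.integral_add Bochner_Integration.integrable_add)
qed

text \<open>
  A space-time test function enters the spatial integral only through the slices at time t of
  itself and of its time derivative.
\<close>
lemma weak_form_slice:
  fixes \<phi> :: "real \<times> real \<times> real \<Rightarrow> real"
  assumes f: "H1 f" and \<phi>: "test_function UNIV \<phi>"
  shows "(LINT p|lebesgue. f p * L_op (Dt \<phi>) (t, p)
           + (3 / 2 * (f p)\<^sup>2 + \<gamma> / 2 * (weak_deriv (1, 0) f p)\<^sup>2) * Dx (Dx \<phi>) (t, p)
           - \<gamma> / 2 * (f p)\<^sup>2 * Dx (Dx (Dx (Dx \<phi>))) (t, p)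
           - \<alpha> * f p * Dy (Dy \<phi>) (t, p)
           + \<beta> * f p * Dx (Dx (Dy (Dy \<phi>))) (t, p))
    = mass_form f (\<lambda>p. Dt \<phi> (t, p)) + flux_form \<alpha> \<beta> \<gamma> f (\<lambda>p. \<phi> (t, p))"
proof -
  note s = test_function_smooth[OF \<phi>] and sd = smooth_dir_deriv
  have "integrable lebesgue (\<lambda>p. f p * Lx (\<lambda>p. Dt \<phi> (t, p)) p)"
    by (intro integrable_mult_L2 H1_L2 f L2_test_function test_function_Lx test_function_slice test_function_dir_deriv \<phi>)
  from Bochner_Integration.integral_add[OF this integrable_flux_form[OF f test_function_slice[OF \<phi>], of \<gamma> t \<alpha> \<beta>]]
  show ?thesis
    unfolding mass_form_def flux_form_def
    by (simp add: slice_L_op slice_dir_deriv_apply s sd algebra_simps)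
qed

lemma dir_deriv_cmult_smooth: "smooth \<psi> \<Longrightarrow> dir_deriv v (\<lambda>p. c * \<psi> p) = (\<lambda>p. c * dir_deriv v \<psi> p)"
  by (auto intro!: dir_deriv_cmult smooth_differentiable)

lemma Lx_cmult: "smooth \<psi> \<Longrightarrow> Lx (\<lambda>p. c * \<psi> p) = (\<lambda>p. c * Lx \<psi> p)"
  by (simp add: Lx_def dir_deriv_cmult_smooth smooth_dir_deriv smooth_diff flip: right_diff_distrib)

lemma mass_form_cmult: "smooth \<psi> \<Longrightarrow> mass_form f (\<lambda>p. c * \<psi> p) = c * mass_form f \<psi>"
  by (simp add: mass_form_def Lx_cmult mult.left_commute[of _ c])

lemma flux_form_cmult:
  assumes "smooth \<psi>"
  shows "flux_form \<alpha> \<beta> \<gamma> f (\<lambda>p. c * \<psi> p) = c * flux_form \<alpha> \<beta> \<gamma> f \<psi>"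
  unfolding flux_form_def integral_mult_right_zero[symmetric]
  by (simp add: dir_deriv_cmult_smooth smooth_dir_deriv assms algebra_simps)

lemma continuous_H1_D:
  assumes "continuous_H1 I u" "t \<in> I"
  shows "H1 (u t)" "L2_tendsto u (u t) (at t within I)"
    "L2_tendsto (\<lambda>s. weak_deriv (1, 0) (u s)) (weak_deriv (1, 0) (u t)) (at t within I)"
proof -
  have S: "\<forall>\<^sub>F s in at t within I. s \<in> I" by (simp add: eventually_at_filter)
  have H: "\<And>s. s \<in> I \<Longrightarrow> H1 (u s)" using assms by (simp add: continuous_H1_def)
  from H assms(2) show "H1 (u t)" by blast
  show "L2_tendsto u (u t) (at t within I)"
    "L2_tendsto (\<lambda>s. weak_deriv (1, 0) (u s)) (weak_deriv (1, 0) (u t)) (at t within I)"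
    using H1_norm_tendsto_iff[of I u "u t", OF H H[OF assms(2)] S] assms by (auto simp: continuous_H1_def)
qed

lemma continuous_on_mass_form:
  assumes u: "continuous_H1 I u" and \<psi>: "test_function UNIV \<psi>"
  shows "continuous_on I (\<lambda>t. mass_form (u t) \<psi>)"
  unfolding continuous_on_def mass_form_def
proof
  fix t assume t: "t \<in> I"
  show "((\<lambda>t. LINT p|lebesgue. u t p * Lx \<psi> p) \<longlongrightarrow> (LINT p|lebesgue. u t p * Lx \<psi> p)) (at t within I)"
    by (rule L2_tendsto_inner[where S=I])
       (auto intro: continuous_H1_D[OF u] t H1_L2 L2_test_function[OF test_function_Lx[OF \<psi>]] simp: eventually_at_filter)
qed

lemma continuous_on_flux_form:
  assumes u: "continuous_H1 I u" and \<psi>: "test_function UNIV \<psi>"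
  shows "continuous_on I (\<lambda>t. flux_form \<alpha> \<beta> \<gamma> (u t) \<psi>)"
proof -
  note t = test_function_dir_deriv[where U=UNIV]
  let ?a = "\<lambda>p. 3 / 2 * dx (dx \<psi>) p - \<gamma> / 2 * dx (dx (dx (dx \<psi>))) p"
  let ?b = "\<lambda>p. \<gamma> / 2 * dx (dx \<psi>) p"
  let ?c = "\<lambda>p. \<beta> * dx (dx (dy (dy \<psi>))) p - \<alpha> * dy (dy \<psi>) p"
  have h: "test_function UNIV ?a" "test_function UNIV ?b" "test_function UNIV ?c"
    by (intro test_function_diff test_function_cmult t \<psi>)+
  have ev: "\<forall>\<^sub>F s in at t within I. s \<in> I" for t by (simp add: eventually_at_filter)
  have quad: "continuous_on I (\<lambda>t. LINT p|lebesgue. w t p * (w t p * a p))"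
    if L: "\<And>t. t \<in> I \<Longrightarrow> L2 (w t)" and lim: "\<And>t. t \<in> I \<Longrightarrow> L2_tendsto w (w t) (at t within I)"
      and a: "test_function UNIV a" for w and a :: "real \<times> real \<Rightarrow> real"
    unfolding continuous_on_def
  proof
    fix t assume t: "t \<in> I"
    obtain C where C: "\<And>p. \<bar>a p\<bar> \<le> C" using test_function_bounded[OF a] by blast
    show "((\<lambda>t. LINT p|lebesgue. w t p * (w t p * a p)) \<longlongrightarrow> (LINT p|lebesgue. w t p * (w t p * a p))) (at t within I)"
      by (rule L2_tendsto_inner[where S=I, OF lim[OF t] L L[OF t]
            L2_tendsto_mult_bounded[where S=I, OF lim[OF t] L L[OF t] ev test_function_measurable[OF a] C]
            L2_mult_test[OF L a] L2_mult_test[OF L[OF t] a] ev])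
  qed
  have lin: "continuous_on I (\<lambda>t. LINT p|lebesgue. u t p * ?c p)"
    unfolding continuous_on_def
  proof
    fix t assume t: "t \<in> I"
    show "((\<lambda>t. LINT p|lebesgue. u t p * ?c p) \<longlongrightarrow> (LINT p|lebesgue. u t p * ?c p)) (at t within I)"
      by (rule L2_tendsto_inner[where S=I, OF continuous_H1_D(2)[OF u t] _ _ L2_tendsto_const _ _ ev])
         (auto intro: continuous_H1_D(1)[OF u] t H1_L2 L2_test_function[OF h(3)])
  qed
  have "continuous_on I (\<lambda>t. (LINT p|lebesgue. u t p * (u t p * ?a p))
    + (LINT p|lebesgue. weak_deriv (1, 0) (u t) p * (weak_deriv (1, 0) (u t) p * ?b p))
    + (LINT p|lebesgue. u t p * ?c p))"
    by (intro continuous_on_add quad[OF _ _ h(1)] quad[OF _ _ h(2)] lin)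
       (auto intro: continuous_H1_D[OF u] H1_L2[OF continuous_H1_D(1)[OF u]]
          H1_weak_deriv(1)[OF continuous_H1_D(1)[OF u]])
  then show ?thesis
    by (rule continuous_on_eq) (simp add: flux_form_eq[OF continuous_H1_D(1)[OF u] \<psi>])
qed

section \<open>Behaviour under translations and reflections\<close>

lemma sign_square: "\<bar>\<sigma>\<bar> = 1 \<Longrightarrow> \<sigma> * \<sigma> = (1::real)"
  by (metis abs_mult_self_eq mult_1)

lemma dir_deriv_aff:
  assumes "smooth \<psi>"
  shows "dx (\<lambda>p. \<psi> (aff \<sigma> s p)) p = \<sigma> * dx \<psi> (aff \<sigma> s p)"
    and "dy (\<lambda>p. \<psi> (aff \<sigma> s p)) p = dy \<psi> (aff \<sigma> s p)"
proof -
  have A: "bounded_linear (\<lambda>p::real \<times> real. (\<sigma> * fst p, snd p))"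
    by (intro bounded_linear_Pair bounded_linear_snd bounded_linear_const_mult bounded_linear_fst)
  have eq: "(\<lambda>p. \<psi> (aff \<sigma> s p)) = (\<lambda>p. \<psi> ((\<sigma> * fst p, snd p) + s))"
    by (simp add: aff_def add.commute)
  have "dir_deriv (\<sigma>, 0) \<psi> q = \<sigma> * dx \<psi> q" for q
    using smooth_dir_deriv_comb[OF assms, of \<sigma> "(1, 0)" 0 "(0, 0)" q] by simp
  then show "dx (\<lambda>p. \<psi> (aff \<sigma> s p)) p = \<sigma> * dx \<psi> (aff \<sigma> s p)"
    using dir_deriv_affine[OF A smooth_differentiable[OF assms], where b=s and v="(1, 0)" and x=p] eq
    by (simp add: aff_def add.commute)
  show "dy (\<lambda>p. \<psi> (aff \<sigma> s p)) p = dy \<psi> (aff \<sigma> s p)"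
    using dir_deriv_affine[OF A smooth_differentiable[OF assms], where b=s and v="(0, 1)" and x=p] eq
    by (simp add: aff_def add.commute)
qed

lemma smooth_aff: "smooth \<psi> \<Longrightarrow> smooth (\<lambda>p. \<psi> (aff \<sigma> s p))"
  using smooth_affine[of \<psi> "\<lambda>p. (\<sigma> * fst p, snd p)" s]
  by (simp add: aff_def add.commute bounded_linear_Pair bounded_linear_snd bounded_linear_const_mult bounded_linear_fst)

lemma test_function_aff:
  fixes \<psi> :: "real \<times> real \<Rightarrow> real"
  assumes \<sigma>: "\<bar>\<sigma>\<bar> = 1" and \<psi>: "test_function UNIV \<psi>"
  shows "test_function UNIV (\<lambda>p. \<psi> (aff \<sigma> s p))"
proof -
  have "linear (\<lambda>p::real \<times> real. (\<sigma> * fst p, snd p))" by (intro linearI) (auto simp: algebra_simps)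
  moreover have "inj (\<lambda>p::real \<times> real. (\<sigma> * fst p, snd p))" using \<sigma> by (auto simp: inj_def prod_eq_iff)
  ultimately show ?thesis
    using test_function_affine[OF \<psi>, of "\<lambda>p. (\<sigma> * fst p, snd p)" s] by (simp add: aff_def add.commute)
qed

text \<open>
  \<open>Lx\<close> consists of derivatives of odd order in x, so a reflection changes its sign.
\<close>
lemma Lx_aff:
  assumes \<sigma>: "\<bar>\<sigma>\<bar> = 1" and \<psi>: "smooth \<psi>"
  shows "Lx (\<lambda>p. \<psi> (aff \<sigma> s p)) p = \<sigma> * Lx \<psi> (aff \<sigma> s p)"
proof -
  have d: "dx (\<lambda>p. h (aff \<sigma> s p)) = (\<lambda>p. \<sigma> * dx h (aff \<sigma> s p))" if "smooth h" for h
    by (rule ext) (rule dir_deriv_aff(1)[OF that])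
  have "dx (dx (\<lambda>p. \<psi> (aff \<sigma> s p))) = (\<lambda>p. dx (dx \<psi>) (aff \<sigma> s p))"
    by (simp add: d \<psi> smooth_dir_deriv smooth_aff dir_deriv_cmult_smooth sign_square[OF \<sigma>] flip: mult.assoc)
  then show ?thesis
    unfolding Lx_def using fun_cong[OF d[OF smooth_diff[OF \<psi> smooth_dir_deriv[OF smooth_dir_deriv[OF \<psi>]]]]] by simp
qed

lemma mass_form_aff:
  assumes \<sigma>: "\<bar>\<sigma>\<bar> = 1" and f: "H1 f" and \<psi>: "test_function UNIV \<psi>"
  shows "mass_form (\<lambda>p. f (aff \<sigma> s p)) (\<lambda>p. \<psi> (aff \<sigma> s p)) = \<sigma> * mass_form f \<psi>"
proof -
  have "mass_form (\<lambda>p. f (aff \<sigma> s p)) (\<lambda>p. \<psi> (aff \<sigma> s p)) = (LINT p|lebesgue. \<sigma> * (f (aff \<sigma> s p) * Lx \<psi> (aff \<sigma> s p)))"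
    by (simp add: mass_form_def Lx_aff[OF \<sigma> test_function_smooth[OF \<psi>]] mult.left_commute)
  also have "\<dots> = \<sigma> * (LINT p|lebesgue. f (aff \<sigma> s p) * Lx \<psi> (aff \<sigma> s p))" by simp
  also have "(LINT p|lebesgue. f (aff \<sigma> s p) * Lx \<psi> (aff \<sigma> s p)) = mass_form f \<psi>"
    unfolding mass_form_def
    by (rule integral_aff[OF \<sigma>, of "\<lambda>p. f p * Lx \<psi> p"])
       (intro borel_measurable_times L2_measurable[OF H1_L2[OF f]] test_function_measurable[OF test_function_Lx[OF \<psi>]])
  finally show ?thesis .
qed

lemma mass_form_cong:
  assumes "H1 f" "H1 g" "AE p in lebesgue. f p = g p" "test_function UNIV \<psi>"
  shows "mass_form f \<psi> = mass_form g \<psi>"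
  unfolding mass_form_def using assms(3)
  by (intro integral_cong_AE borel_measurable_times L2_measurable[OF H1_L2] assms(1,2)
      test_function_measurable[OF test_function_Lx[OF assms(4)]]) auto

lemma flux_form_cong:
  assumes f: "H1 f" and g: "H1 g" and eq: "AE p in lebesgue. f p = g p" and \<psi>: "test_function UNIV \<psi>"
  shows "flux_form \<alpha> \<beta> \<gamma> f \<psi> = flux_form \<alpha> \<beta> \<gamma> g \<psi>"
  unfolding flux_form_def
proof (rule integral_cong_AE)
  have "AE p in lebesgue. weak_deriv (1, 0) f p = weak_deriv (1, 0) g p"
    by (rule AE_eq_H1_weak_deriv[OF f g eq]) simp
  with eq show "AE p in lebesgue. (3 / 2 * (f p)\<^sup>2 + \<gamma> / 2 * (weak_deriv (1, 0) f p)\<^sup>2) * dx (dx \<psi>) p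
     - \<gamma> / 2 * (f p)\<^sup>2 * dx (dx (dx (dx \<psi>))) p - \<alpha> * f p * dy (dy \<psi>) p
     + \<beta> * f p * dx (dx (dy (dy \<psi>))) p =
     (3 / 2 * (g p)\<^sup>2 + \<gamma> / 2 * (weak_deriv (1, 0) g p)\<^sup>2) * dx (dx \<psi>) p
     - \<gamma> / 2 * (g p)\<^sup>2 * dx (dx (dx (dx \<psi>))) p - \<alpha> * g p * dy (dy \<psi>) p
     + \<beta> * g p * dx (dx (dy (dy \<psi>))) p"
    by eventually_elim simp
qed (use integrable_flux_form[OF f \<psi>] integrable_flux_form[OF g \<psi>] in blast)+

text \<open>
  Only even orders of x-derivatives of the test function occur here, and the weak x-derivative of
  f enters squared, so no sign survives a reflection.
\<close>
lemma flux_form_aff: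
  assumes \<sigma>: "\<bar>\<sigma>\<bar> = 1" and f: "H1 f" and \<psi>: "test_function UNIV \<psi>"
  shows "flux_form \<alpha> \<beta> \<gamma> (\<lambda>p. f (aff \<sigma> s p)) (\<lambda>p. \<psi> (aff \<sigma> s p)) = flux_form \<alpha> \<beta> \<gamma> f \<psi>"
proof -
  let ?F = "\<lambda>p. (3 / 2 * (f p)\<^sup>2 + \<gamma> / 2 * (weak_deriv (1, 0) f p)\<^sup>2) * dx (dx \<psi>) p
     - \<gamma> / 2 * (f p)\<^sup>2 * dx (dx (dx (dx \<psi>))) p - \<alpha> * f p * dy (dy \<psi>) p
     + \<beta> * f p * dx (dx (dy (dy \<psi>))) p"
  have d: "dx (\<lambda>p. h (aff \<sigma> s p)) = (\<lambda>p. \<sigma> * dx h (aff \<sigma> s p))"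
     "dy (\<lambda>p. h (aff \<sigma> s p)) = (\<lambda>p. dy h (aff \<sigma> s p))" if "smooth h" for h
    by (auto simp: dir_deriv_aff[OF that])
  have d2: "dx (dx (\<lambda>p. h (aff \<sigma> s p))) = (\<lambda>p. dx (dx h) (aff \<sigma> s p))" if "smooth h" for h
    using that by (simp add: d smooth_dir_deriv smooth_aff dir_deriv_cmult_smooth sign_square[OF \<sigma>] flip: mult.assoc)
  note s = test_function_smooth[OF \<psi>]
  note I = integrable_flux_form[OF f \<psi>, of \<gamma> \<alpha> \<beta>]
  have "flux_form \<alpha> \<beta> \<gamma> (\<lambda>p. f (aff \<sigma> s p)) (\<lambda>p. \<psi> (aff \<sigma> s p)) = (LINT p|lebesgue. ?F (aff \<sigma> s p))"
    unfolding flux_form_def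
  proof (rule integral_cong_AE)
    have sq: "(weak_deriv (1, 0) (\<lambda>p. f (aff \<sigma> s p)) p)\<^sup>2 = (weak_deriv (1, 0) f (aff \<sigma> s p))\<^sup>2"
      if "weak_deriv (1, 0) (\<lambda>p. f (aff \<sigma> s p)) p = \<sigma> * weak_deriv (1, 0) f (aff \<sigma> s p)" for p
      unfolding that power_mult_distrib by (simp add: power2_eq_square sign_square[OF \<sigma>])
    have "AE p in lebesgue. (weak_deriv (1, 0) (\<lambda>p. f (aff \<sigma> s p)) p)\<^sup>2 = (weak_deriv (1, 0) f (aff \<sigma> s p))\<^sup>2"
      using weak_deriv_x_aff[OF \<sigma> f, of s] by eventually_elim (rule sq)
    then show "AE p in lebesgue. (3 / 2 * (f (aff \<sigma> s p))\<^sup>2 + \<gamma> / 2 * (weak_deriv (1, 0) (\<lambda>p. f (aff \<sigma> s p)) p)\<^sup>2) * dx (dx (\<lambda>p. \<psi> (aff \<sigma> s p))) p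
       - \<gamma> / 2 * (f (aff \<sigma> s p))\<^sup>2 * dx (dx (dx (dx (\<lambda>p. \<psi> (aff \<sigma> s p))))) p - \<alpha> * f (aff \<sigma> s p) * dy (dy (\<lambda>p. \<psi> (aff \<sigma> s p))) p
       + \<beta> * f (aff \<sigma> s p) * dx (dx (dy (dy (\<lambda>p. \<psi> (aff \<sigma> s p))))) p = ?F (aff \<sigma> s p)"
      by eventually_elim (simp add: d2 d(2) s smooth_dir_deriv)
    show "(\<lambda>p. ?F (aff \<sigma> s p)) \<in> borel_measurable lebesgue"
      by (rule measurable_compose_aff[OF \<sigma>, of ?F]) (use I in blast)
  qed (use integrable_flux_form[OF H1_aff[OF \<sigma> f] test_function_aff[OF \<sigma> \<psi>]] in blast)
  also have "\<dots> = flux_form \<alpha> \<beta> \<gamma> f \<psi>"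
    unfolding flux_form_def by (rule integral_aff[OF \<sigma>, of ?F]) (use I in blast)
  finally show ?thesis .
qed

section \<open>The profile equation of a symmetric solution\<close>

text \<open>
  The evolution equation in the form in which the symmetry argument uses it. It comes from testing with
  products \<open>\<rho> t * \<psi> p\<close>, so no test functions of limited regularity in time arise although the axis of
  symmetry is only once continuously differentiable.
\<close>
lemma mass_form_has_derivative:
  assumes u: "weak_solution \<alpha> \<beta> \<gamma> T u" and t: "t \<in> {0<..<T}" and \<psi>: "test_function UNIV \<psi>"
  shows "((\<lambda>t. mass_form (u t) \<psi>) has_real_derivative flux_form \<alpha> \<beta> \<gamma> (u t) \<psi>) (at t)"
proof (rule du_Bois_Reymond[OF _ _ _ t])
  have cu: "continuous_H1 {0..T} u" using u by (simp add: weak_solution_def)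
  note s = test_function_smooth[OF \<psi>]
  show cm: "continuous_on {0..T} (\<lambda>t. mass_form (u t) \<psi>)" by (rule continuous_on_mass_form[OF cu \<psi>])
  show cf: "continuous_on {0..T} (\<lambda>t. flux_form \<alpha> \<beta> \<gamma> (u t) \<psi>)" by (rule continuous_on_flux_form[OF cu \<psi>])
  fix \<rho> \<rho>' assume \<rho>: "bump_with_derivative T \<rho> \<rho>'"
  let ?\<phi> = "\<lambda>q. \<rho> (fst q) * \<psi> (snd q)"
  let ?I = "\<lambda>t. \<rho>' t * mass_form (u t) \<psi> + \<rho> t * flux_form \<alpha> \<beta> \<gamma> (u t) \<psi>"
  note t\<phi> = test_function_tensor[OF \<rho> \<psi>]
  note t\<phi>' = test_function_mono[OF t\<phi> subset_UNIV]
  have Dt: "Dt ?\<phi> (t, p) = \<rho>' t * \<psi> p" for t p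
  proof -
    have "((\<lambda>r. ?\<phi> ((0, p) + r *\<^sub>R (1, 0, 0))) has_real_derivative Dt ?\<phi> ((0, p) + t *\<^sub>R (1, 0, 0))) (at t)"
      by (rule smooth_has_real_derivative_line[OF test_function_smooth[OF t\<phi>]])
    then have "((\<lambda>r. \<rho> r * \<psi> p) has_real_derivative Dt ?\<phi> (t, p)) (at t)"
      by (cases p) simp
    moreover have "((\<lambda>r. \<rho> r * \<psi> p) has_real_derivative \<rho>' t * \<psi> p) (at t)"
      using \<rho> by (auto simp: bump_with_derivative_def intro!: derivative_eq_intros)
    ultimately show ?thesis by (rule DERIV_unique)
  qed
  have "(LINT t:{0..T}|lebesgue. ?I t) = (LINT t:{0..T}|lebesgue. (LINT p|lebesgue.
             u t p * L_op (Dt ?\<phi>) (t, p)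
           + (3 / 2 * (u t p)\<^sup>2 + \<gamma> / 2 * (weak_deriv (1, 0) (u t) p)\<^sup>2) * Dx (Dx ?\<phi>) (t, p)
           - \<gamma> / 2 * (u t p)\<^sup>2 * Dx (Dx (Dx (Dx ?\<phi>))) (t, p)
           - \<alpha> * u t p * Dy (Dy ?\<phi>) (t, p)
           + \<beta> * u t p * Dx (Dx (Dy (Dy ?\<phi>))) (t, p)))"
  proof (rule set_lebesgue_integral_cong)
    show "\<forall>t. t \<in> {0..T} \<longrightarrow> ?I t = (LINT p|lebesgue.
             u t p * L_op (Dt ?\<phi>) (t, p)
           + (3 / 2 * (u t p)\<^sup>2 + \<gamma> / 2 * (weak_deriv (1, 0) (u t) p)\<^sup>2) * Dx (Dx ?\<phi>) (t, p)
           - \<gamma> / 2 * (u t p)\<^sup>2 * Dx (Dx (Dx (Dx ?\<phi>))) (t, p)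
           - \<alpha> * u t p * Dy (Dy ?\<phi>) (t, p)
           + \<beta> * u t p * Dx (Dx (Dy (Dy ?\<phi>))) (t, p))"
      by (intro allI impI, subst weak_form_slice[OF continuous_H1_D(1)[OF cu] t\<phi>'])
        (simp_all add: Dt mass_form_cmult[OF s] flux_form_cmult[OF s])
  qed simp
  also have "\<dots> = 0" using u t\<phi> by (auto simp: weak_solution_def)
  finally have 0: "(LINT t:{0..T}|lebesgue. ?I t) = 0" .
  have "continuous_on {0..T} ?I"
    using \<rho> by (intro continuous_intros cm cf) (auto simp: bump_with_derivative_def intro: smooth_continuous)
  then have "set_integrable lebesgue {0..T} ?I" by (rule absolutely_integrable_continuous_real)
  from set_lebesgue_integral_eq_integral(2)[OF this] 0 show "integral {0..T} ?I = 0" by simp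
qed

lemma Lx_dx: assumes "smooth \<psi>" shows "Lx (dx \<psi>) = dx (Lx \<psi>)"
proof -
  note s = smooth_dir_deriv[where v="(1, 0)"]
  have "dx (\<lambda>p. \<psi> p - dx (dx \<psi>) p) = (\<lambda>p. dx \<psi> p - dx (dx (dx \<psi>)) p)"
    using assms by (auto intro!: dir_deriv_diff smooth_differentiable s)
  then show ?thesis by (simp add: Lx_def)
qed

text \<open>
  Reflection at the line \<open>x = a / 2\<close>. Moving the axis differentiates the test function,
  so the derivative in a is the same pairing with \<open>\<psi>\<close> replaced by its x-derivative.
\<close>
lemma mass_form_reflect_has_derivative:
  assumes f: "H1 f" and \<psi>: "test_function UNIV \<psi>"
  shows "((\<lambda>a. mass_form f (\<lambda>p. \<psi> (aff (-1) (a, 0) p))) has_real_derivative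
     mass_form f (\<lambda>p. dx \<psi> (aff (-1) (a, 0) p))) (at a)"
proof -
  let ?H = "Lx \<psi>"
  have tH: "test_function UNIV ?H" by (rule test_function_Lx[OF \<psi>])
  note sH = test_function_smooth[OF tH] and s\<psi> = test_function_smooth[OF \<psi>]
  define A where "A q = (fst q - fst (snd q), snd (snd q))" for q :: "real \<times> real \<times> real"
  have A: "bounded_linear A"
    unfolding A_def[abs_def]
    by (intro bounded_linear_Pair bounded_linear_sub bounded_linear_fst
        bounded_linear_compose[OF bounded_linear_fst bounded_linear_snd]
        bounded_linear_compose[OF bounded_linear_snd bounded_linear_snd])
  have Aaff: "A (a, p) = aff (-1) (a, 0) p" for a p by (simp add: A_def aff_def)
  \<comment> \<open>The sign comes from \<open>Lx\<close> being odd under the reflection.\<close>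
  define \<Phi> where "\<Phi> q = -1 * ?H (A q)" for q
  have s\<Phi>: "smooth \<Phi>"
    unfolding \<Phi>_def[abs_def] using smooth_affine[OF sH A, of 0] by (intro smooth_cmult) simp
  have "((\<lambda>a. LINT p|lebesgue. f p * \<Phi> (a, p)) has_real_derivative
    (LINT p|lebesgue. f p * dir_deriv (1, 0, 0) \<Phi> (a, p))) (at a)"
  proof (rule has_real_derivative_integral_param[OF H1_L2[OF f] s\<Phi>])
    fix r
    obtain B where B: "\<And>p. norm p > B \<Longrightarrow> ?H p = 0"
      using tH unfolding test_function_UNIV_iff by blast
    have "\<Phi> (t, p) = 0" if "\<bar>t\<bar> \<le> r" "norm p > B + r" for t p
    proof -
      have "norm p = norm (- fst p, snd p)" by (cases p) (simp add: norm_Pair)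
      also have "(- fst p, snd p) = aff (-1) (t, 0) p - (t, 0)" by (simp add: aff_def)
      also have "norm \<dots> \<le> norm (aff (-1) (t, 0) p) + norm (t, 0::real)" by (rule norm_triangle_ineq4)
      finally have "norm (aff (-1) (t, 0) p) > B" using that by (simp add: norm_Pair)
      then show ?thesis by (simp add: \<Phi>_def Aaff B)
    qed
    then show "\<exists>B. \<forall>t p. \<bar>t\<bar> \<le> r \<longrightarrow> norm p > B \<longrightarrow> \<Phi> (t, p) = 0" by blast
  qed
  moreover have "\<Phi> (a, p) = Lx (\<lambda>p. \<psi> (aff (-1) (a, 0) p)) p" for a p
    using Lx_aff[of "-1" \<psi> "(a, 0)" p] s\<psi> by (simp add: \<Phi>_def Aaff)
  moreover have "dir_deriv (1, 0, 0) \<Phi> (a, p) = Lx (\<lambda>p. dx \<psi> (aff (-1) (a, 0) p)) p" for a p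
  proof -
    have "dir_deriv (1, 0, 0) \<Phi> (a, p) = -1 * dir_deriv (1, 0, 0) (\<lambda>q. ?H (A q)) (a, p)"
      unfolding \<Phi>_def[abs_def]
      using smooth_affine[OF sH A, of 0] by (intro dir_deriv_cmult smooth_differentiable) simp
    also have "dir_deriv (1, 0, 0) (\<lambda>q. ?H (A q)) (a, p) = dir_deriv (A (1, 0, 0)) ?H (A (a, p))"
      using dir_deriv_affine[OF A smooth_differentiable[OF sH], where b=0 and x="(a, p)"] by simp
    also have "\<dots> = Lx (dx \<psi>) (aff (-1) (a, 0) p)"
      using Aaff[of a p] by (simp add: Lx_dx[OF s\<psi>] A_def)
    finally show ?thesis
      using Lx_aff[of "-1" "dx \<psi>" "(a, 0)" p] smooth_dir_deriv[OF s\<psi>] by simp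
  qed
  ultimately show ?thesis by (simp add: mass_form_def)
qed

text \<open>
  Since f is its own reflection, reflecting the test function amounts to reflecting both
  arguments, where the two forms are odd and even.
\<close>
lemma H1_symmetric_forms:
  assumes f: "H1 f" and sym: "AE p in lebesgue. f p = f (aff (-1) (a, 0) p)" and \<psi>: "test_function UNIV \<psi>"
  shows "mass_form f (\<lambda>p. \<psi> (aff (-1) (a, 0) p)) = - mass_form f \<psi>"
    and "flux_form \<alpha> \<beta> \<gamma> f (\<lambda>p. \<psi> (aff (-1) (a, 0) p)) = flux_form \<alpha> \<beta> \<gamma> f \<psi>"
proof -
  have m: "\<bar>-1 :: real\<bar> = 1" by simp
  note t = test_function_aff[OF m \<psi>, of "(a, 0)"]
  show "mass_form f (\<lambda>p. \<psi> (aff (-1) (a, 0) p)) = - mass_form f \<psi>"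
    using mass_form_cong[OF f H1_aff[OF m f] sym t] mass_form_aff[OF m f \<psi>] by simp
  show "flux_form \<alpha> \<beta> \<gamma> f (\<lambda>p. \<psi> (aff (-1) (a, 0) p)) = flux_form \<alpha> \<beta> \<gamma> f \<psi>"
    using flux_form_cong[OF f H1_aff[OF m f] sym t] flux_form_aff[OF m f \<psi>] by simp
qed

text \<open>
  The heart of the argument. By symmetry \<open>mass_form (u s) \<psi>\<close> is minus the pairing G of \<open>u s\<close> with \<open>\<psi>\<close>
  reflected at the axis of time s. Differentiate both sides at t. The left-hand side gives
  \<open>flux_form (u t) \<psi>\<close>. On the right-hand side the change of u gives minus the same quantity, because the
  flux is even, and the motion of the axis gives \<open>2 * c * mass_form (u t) (dx \<psi>)\<close>. Hence twice the
  flux equals twice the transport term.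
\<close>
lemma symmetric_flux_form_interior:
  assumes u: "weak_solution \<alpha> \<beta> \<gamma> T u" and \<psi>: "test_function UNIV \<psi>"
    and l: "(l has_real_derivative c) (at t)" and t: "t \<in> {0<..<T}"
    and sym: "\<And>s. s \<in> {0..T} \<Longrightarrow> AE p in lebesgue. u s p = u s (aff (-1) (2 * l s, 0) p)"
  shows "flux_form \<alpha> \<beta> \<gamma> (u t) \<psi> = c * mass_form (u t) (dx \<psi>)"
proof -
  have cu: "continuous_H1 {0..T} u" using u by (simp add: weak_solution_def)
  let ?X = "{0<..<T}"
  have X: "s \<in> {0..T}" if "s \<in> ?X" for s using that by auto
  have H: "H1 (u s)" if "s \<in> ?X" for s using continuous_H1_D(1)[OF cu X[OF that]] .
  note d\<psi> = test_function_dir_deriv[OF \<psi>, of "(1, 0)"]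
  have m: "\<bar>-1 :: real\<bar> = 1" by simp
  define G where "G s a = mass_form (u s) (\<lambda>p. \<psi> (aff (-1) (a, 0) p))" for s a
  define K where "K s a = mass_form (u s) (\<lambda>p. dx \<psi> (aff (-1) (a, 0) p))" for s a
  let ?a = "2 * l t"
  \<comment> \<open>One partial derivative has to be jointly continuous for the chain rule; the one in a is
    given by a pairing whose two factors converge separately.\<close>
  have Kcont: "((\<lambda>(s, a). K s a) \<longlongrightarrow> K t ?a) (at (t, ?a) within ?X \<times> UNIV)"
  proof -
    let ?F = "at (t, ?a) within ?X \<times> UNIV"
    have S: "\<forall>\<^sub>F q in ?F. q \<in> ?X \<times> UNIV" by (simp add: eventually_at_filter)
    have lim: "(fst \<longlongrightarrow> t) ?F" "(snd \<longlongrightarrow> ?a) ?F"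
      using tendsto_fst[OF tendsto_ident_at, of "(t, ?a)"] tendsto_snd[OF tendsto_ident_at, of "(t, ?a)"] by auto
    have "continuous (at t within {0..T}) (\<lambda>s. LINT p|lebesgue. (u s p - u t p)\<^sup>2)"
      using continuous_H1_D(2)[OF cu X[OF t]] by (simp add: continuous_within L2_tendsto_def)
    from continuous_within_tendsto_compose[OF this eventually_mono[OF S] lim(1)]
    have Lu: "L2_tendsto (\<lambda>q. u (fst q)) (u t) ?F"
      by (auto simp: L2_tendsto_def)
    have tL: "test_function UNIV (Lx (dx \<psi>))" by (rule test_function_Lx[OF d\<psi>])
    have La: "L2_tendsto (\<lambda>q p. Lx (dx \<psi>) (aff (-1) (snd q, 0) p)) (\<lambda>p. Lx (dx \<psi>) (aff (-1) (?a, 0) p)) ?F"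
      by (rule L2_tendsto_aff[OF L2_test_function[OF tL] m]) (intro tendsto_Pair lim tendsto_const)
    have "((\<lambda>q. LINT p|lebesgue. u (fst q) p * Lx (dx \<psi>) (aff (-1) (snd q, 0) p)) \<longlongrightarrow>
       (LINT p|lebesgue. u t p * Lx (dx \<psi>) (aff (-1) (?a, 0) p))) ?F"
      by (rule L2_tendsto_inner[where S="?X \<times> UNIV", OF Lu _ _ La _ _ S])
         (auto intro: H1_L2[OF H] t L2_aff[OF m] L2_test_function[OF tL] simp del: greaterThanLessThan_iff)
    moreover have "K s a = - (LINT p|lebesgue. u s p * Lx (dx \<psi>) (aff (-1) (a, 0) p))" for s a
      using Lx_aff[OF m, of "dx \<psi>" "(a, 0)"] test_function_smooth[OF d\<psi>] by (simp add: K_def mass_form_def)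
    ultimately show ?thesis unfolding case_prod_beta by (simp add: tendsto_minus)
  qed
  have "((\<lambda>(s, a). G s a) has_derivative
     (\<lambda>(ts, ta). flux_form \<alpha> \<beta> \<gamma> (u t) (\<lambda>p. \<psi> (aff (-1) (?a, 0) p)) * ts + blinfun_mult_right (K t ?a) ta))
     (at (t, ?a) within ?X \<times> UNIV)"
  proof (rule has_derivative_partialsI[where fy="\<lambda>s a. blinfun_mult_right (K s a)"])
    show "((\<lambda>s. G s ?a) has_derivative (*) (flux_form \<alpha> \<beta> \<gamma> (u t) (\<lambda>p. \<psi> (aff (-1) (?a, 0) p)))) (at t within ?X)"
      using has_field_derivative_at_within[OF mass_form_has_derivative[OF u t test_function_aff[OF m \<psi>]]]
      unfolding G_def has_field_derivative_def .
    show "(G s has_derivative blinfun_mult_right (K s a)) (at a within UNIV)" if "s \<in> ?X" for s a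
      unfolding has_field_derivative_eq_has_derivative_blinfun[symmetric] G_def K_def
      by (rule mass_form_reflect_has_derivative[OF H[OF that] \<psi>])
    show "continuous (at (t, ?a) within ?X \<times> UNIV) (\<lambda>(s, a). blinfun_mult_right (K s a))"
      using bounded_linear.tendsto[OF bounded_linear_blinfun_mult_right Kcont]
      unfolding continuous_within case_prod_beta by simp
  qed auto
  moreover have "at (t, ?a) within ?X \<times> UNIV = at (t, ?a)"
    by (rule at_within_open) (use t in \<open>auto intro: open_Times\<close>)
  ultimately have dG: "((\<lambda>q. G (fst q) (snd q)) has_derivative
     (\<lambda>q. flux_form \<alpha> \<beta> \<gamma> (u t) (\<lambda>p. \<psi> (aff (-1) (?a, 0) p)) * fst q + K t ?a * snd q)) (at (t, ?a))"
    unfolding case_prod_beta by simp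
  have "((\<lambda>s. (s, 2 * l s)) has_derivative (\<lambda>h. (h, 2 * (c * h)))) (at t)"
    using l by (auto intro!: derivative_eq_intros has_derivative_Pair simp: has_field_derivative_def)
  from has_derivative_compose[OF this dG]
  have "((\<lambda>s. G s (2 * l s)) has_derivative
     (\<lambda>h. flux_form \<alpha> \<beta> \<gamma> (u t) (\<lambda>p. \<psi> (aff (-1) (?a, 0) p)) * h + K t ?a * (2 * (c * h)))) (at t)"
    by simp
  then have "((\<lambda>s. G s (2 * l s)) has_real_derivative
     flux_form \<alpha> \<beta> \<gamma> (u t) (\<lambda>p. \<psi> (aff (-1) (?a, 0) p)) + K t ?a * (2 * c)) (at t)"
    unfolding has_field_derivative_def
    by (rule has_derivative_eq_rhs) (simp add: fun_eq_iff algebra_simps)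
  moreover have "((\<lambda>s. - mass_form (u s) \<psi>) has_real_derivative - flux_form \<alpha> \<beta> \<gamma> (u t) \<psi>) (at t)"
    by (intro DERIV_minus mass_form_has_derivative[OF u t \<psi>])
  then have "((\<lambda>s. G s (2 * l s)) has_real_derivative - flux_form \<alpha> \<beta> \<gamma> (u t) \<psi>) (at t)"
  proof (rule has_field_derivative_transform_within_open[OF _ open_greaterThanLessThan t])
    show "- mass_form (u s) \<psi> = G s (2 * l s)" if "s \<in> ?X" for s
      unfolding G_def using H1_symmetric_forms(1)[OF H[OF that] sym[OF X[OF that]] \<psi>] by simp
  qed
  ultimately have "flux_form \<alpha> \<beta> \<gamma> (u t) (\<lambda>p. \<psi> (aff (-1) (?a, 0) p)) + K t ?a * (2 * c) = - flux_form \<alpha> \<beta> \<gamma> (u t) \<psi>"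
    by (rule DERIV_unique)
  then show ?thesis
    unfolding K_def H1_symmetric_forms(1)[OF H[OF t] sym[OF X[OF t]] d\<psi>]
      H1_symmetric_forms(2)[OF H[OF t] sym[OF X[OF t]] \<psi>] by simp
qed

text \<open>
  Both sides are continuous up to the end points of the time interval, which covers initial times
  at either end.
\<close>
lemma symmetric_flux_form:
  assumes T: "T > 0" and u: "weak_solution \<alpha> \<beta> \<gamma> T u" and \<psi>: "test_function UNIV \<psi>"
    and l: "\<And>t. (l has_real_derivative l' t) (at t)" "continuous_on UNIV l'" and t: "t \<in> {0..T}"
    and sym: "\<And>s. s \<in> {0..T} \<Longrightarrow> AE p in lebesgue. u s p = u s (aff (-1) (2 * l s, 0) p)"
  shows "flux_form \<alpha> \<beta> \<gamma> (u t) \<psi> = l' t * mass_form (u t) (dx \<psi>)"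
proof -
  have cu: "continuous_H1 {0..T} u" using u by (simp add: weak_solution_def)
  have cl: "closure {0<..<T} = {0..T}" using T by simp
  have "flux_form \<alpha> \<beta> \<gamma> (u t) \<psi> - l' t * mass_form (u t) (dx \<psi>) = 0"
  proof (rule continuous_constant_on_closure[where S="{0<..<T}" and x=t
        and f="\<lambda>t. flux_form \<alpha> \<beta> \<gamma> (u t) \<psi> - l' t * mass_form (u t) (dx \<psi>)"])
    show "continuous_on (closure {0<..<T}) (\<lambda>t. flux_form \<alpha> \<beta> \<gamma> (u t) \<psi> - l' t * mass_form (u t) (dx \<psi>))"
      unfolding cl
      by (intro continuous_intros continuous_on_flux_form[OF cu \<psi>]
          continuous_on_mass_form[OF cu test_function_dir_deriv[OF \<psi>]] continuous_on_subset[OF l(2)]) auto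
    show "flux_form \<alpha> \<beta> \<gamma> (u s) \<psi> - l' s * mass_form (u s) (dx \<psi>) = 0" if "s \<in> {0<..<T}" for s
      using symmetric_flux_form_interior[OF u \<psi> l(1) that sym] by simp
  qed (use t cl in simp)
  then show ?thesis by simp
qed

section \<open>Traveling waves as weak solutions\<close>

lemma L2_tendsto_cong_AE:
  assumes f: "\<And>i. i \<in> S \<Longrightarrow> AE p in lebesgue. f i p = f' i p" "AE p in lebesgue. g p = g' p"
    and L: "\<And>i. i \<in> S \<Longrightarrow> L2 (f i)" "\<And>i. i \<in> S \<Longrightarrow> L2 (f' i)" "L2 g" "L2 g'"
    and S: "\<forall>\<^sub>F i in F. i \<in> S" and lim: "L2_tendsto f' g' F"
  shows "L2_tendsto f g F"
  unfolding L2_tendsto_def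
proof (rule Lim_transform_eventually[OF lim[unfolded L2_tendsto_def]])
  show "\<forall>\<^sub>F i in F. (LINT p|lebesgue. (f' i p - g' p)\<^sup>2) = (LINT p|lebesgue. (f i p - g p)\<^sup>2)"
    using S
  proof eventually_elim
    case (elim i)
    show ?case
    proof (rule integral_cong_AE)
      show "AE p in lebesgue. (f' i p - g' p)\<^sup>2 = (f i p - g p)\<^sup>2"
        using f(1)[OF elim] f(2) by eventually_elim simp
    qed (intro borel_measurable_power L2_measurable L2_diff L elim)+
  qed
qed

text \<open>
  Translations act continuously on square-integrable functions, here on f and its weak derivatives.
\<close>
lemma continuous_H1_translate:
  assumes f: "H1 f" and a: "continuous_on I a"
  shows "continuous_H1 I (\<lambda>t p. f (aff 1 (a t) p))"
  unfolding continuous_H1_def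
proof safe
  have one: "\<bar>1 :: real\<bar> = 1" by simp
  note Hs = H1_aff[OF one f]
  show "H1 (\<lambda>p. f (aff 1 (a t) p))" for t by (rule Hs)
  fix t assume t: "t \<in> I"
  have S: "\<forall>\<^sub>F s in at t within I. s \<in> I" by (simp add: eventually_at_filter)
  have lim: "(a \<longlongrightarrow> a t) (at t within I)" using a t by (simp add: continuous_on_def)
  note wx = H1_weak_deriv[OF f, of "(1, 0)", simplified] and wy = H1_weak_deriv[OF f, of "(0, 1)", simplified]
  have "L2_tendsto (\<lambda>s. weak_deriv (1, 0) (\<lambda>p. f (aff 1 (a s) p))) (weak_deriv (1, 0) (\<lambda>p. f (aff 1 (a t) p))) (at t within I)"
    by (rule L2_tendsto_cong_AE[OF _ _ _ _ _ _ S L2_tendsto_aff[OF wx(1) one lim]])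
      (use weak_deriv_x_aff[OF one f] H1_weak_deriv(1)[OF Hs] L2_aff[OF one wx(1)] in simp_all)
  moreover have "L2_tendsto (\<lambda>s. weak_deriv (0, 1) (\<lambda>p. f (aff 1 (a s) p))) (weak_deriv (0, 1) (\<lambda>p. f (aff 1 (a t) p))) (at t within I)"
    by (rule L2_tendsto_cong_AE[OF _ _ _ _ _ _ S L2_tendsto_aff[OF wy(1) one lim]])
      (use weak_deriv_y_aff[OF one f] H1_weak_deriv(1)[OF Hs] L2_aff[OF one wy(1)] in simp_all)
  ultimately show "((\<lambda>s. H1_norm (\<lambda>p. f (aff 1 (a s) p) - f (aff 1 (a t) p))) \<longlongrightarrow> 0) (at t within I)"
    using H1_norm_tendsto_iff[where S=I and f="\<lambda>s p. f (aff 1 (a s) p)", OF Hs Hs S]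
      L2_tendsto_aff[OF H1_L2[OF f] one lim] by simp
qed

text \<open>
  The hypothesis is the profile equation of a wave of speed c. After the spatial change of
  variables to the moving frame, it turns the integrand of the weak formulation at time t into
  the integral of f against \<open>(\<partial>\<^sub>t + c \<partial>\<^sub>x) L \<phi>\<close> along the shear \<open>(t, x, y) \<mapsto> (t, x + c (t - t0), y)\<close>.
  That is the time derivative of the integral of f against the sheared \<open>L \<phi>\<close>, which vanishes at both ends of the
  time interval.
\<close>
lemma weak_solution_traveling:
  assumes T: "T > 0" and f: "H1 f"
    and bal: "\<And>\<psi>. test_function UNIV \<psi> \<Longrightarrow> flux_form \<alpha> \<beta> \<gamma> f \<psi> = c * mass_form f (dx \<psi>)"
  shows "weak_solution \<alpha> \<beta> \<gamma> T (\<lambda>t p. f (aff 1 (- (c * (t - t0)), 0) p))"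
proof -
  define v where "v t p = f (aff 1 (- (c * (t - t0)), 0) p)" for t p
  have one: "\<bar>1 :: real\<bar> = 1" by simp
  have Hv: "H1 (v t)" for t unfolding v_def by (rule H1_aff[OF one f])
  have cv: "continuous_H1 {0..T} v"
    unfolding v_def[abs_def] by (intro continuous_H1_translate f continuous_intros)
  have "(LINT t:{0..T}|lebesgue. (LINT p|lebesgue.
             v t p * L_op (Dt \<phi>) (t, p)
           + (3 / 2 * (v t p)\<^sup>2 + \<gamma> / 2 * (weak_deriv (1, 0) (v t) p)\<^sup>2) * Dx (Dx \<phi>) (t, p)
           - \<gamma> / 2 * (v t p)\<^sup>2 * Dx (Dx (Dx (Dx \<phi>))) (t, p)
           - \<alpha> * v t p * Dy (Dy \<phi>) (t, p)
           + \<beta> * v t p * Dx (Dx (Dy (Dy \<phi>))) (t, p))) = 0"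
    if \<phi>: "test_function ({0<..<T} \<times> UNIV) \<phi>" for \<phi>
  proof -
    note \<phi>U = test_function_mono[OF \<phi> subset_UNIV]
    note s\<phi> = test_function_smooth[OF \<phi>]
    have tL: "test_function ({0<..<T} \<times> UNIV) (L_op \<phi>)"
      unfolding L_op_def by (intro test_function_dir_deriv test_function_diff \<phi>)
    note tLU = test_function_mono[OF tL subset_UNIV] and sL = test_function_smooth[OF tL]
    \<comment> \<open>The linear part of the shear; b accounts for the reference time \<open>t0\<close>.\<close>
    define A where "A q = (fst q, c * fst q + fst (snd q), snd (snd q))" for q :: "real \<times> real \<times> real"
    define b where "b = (0 :: real, - (c * t0), 0 :: real)"
    have A: "linear A" unfolding A_def[abs_def] by (intro linearI) (auto simp: algebra_simps)
    have iA: "inj A" by (auto simp: inj_def A_def prod_eq_iff)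
    define \<Phi> where "\<Phi> q = L_op \<phi> (A q + b)" for q
    have t\<Phi>: "test_function UNIV \<Phi>"
      unfolding \<Phi>_def[abs_def] by (rule test_function_affine[OF tLU A iA])
    have Ab: "A (t, p) + b = (t, aff 1 (c * (t - t0), 0) p)" for t p
      by (cases p) (simp add: A_def b_def aff_def algebra_simps)
    have D: "((\<lambda>t. LINT p|lebesgue. f p * \<Xi> (t, p)) has_real_derivative
        (LINT p|lebesgue. f p * Dt \<Xi> (t, p))) (at t)" if \<Xi>: "test_function UNIV \<Xi>" for \<Xi> t
    proof (rule has_real_derivative_integral_param[OF H1_L2[OF f] test_function_smooth[OF \<Xi>]])
      obtain B where B: "\<And>q. norm q > B \<Longrightarrow> \<Xi> q = 0" using \<Xi> unfolding test_function_UNIV_iff by blast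
      have "\<Xi> (t, p) = 0" if "norm p > B" for t p
      proof (rule B)
        show "norm (t, p) > B" using that norm_snd_le[of p t] by linarith
      qed
      then show "\<exists>B. \<forall>t p. \<bar>t\<bar> \<le> r \<longrightarrow> norm p > B \<longrightarrow> \<Xi> (t, p) = 0" for r by blast
    qed
    let ?J = "\<lambda>t. LINT p|lebesgue. f p * Dt \<Phi> (t, p)"
    have inner: "mass_form (v t) (\<lambda>p. Dt \<phi> (t, p)) + flux_form \<alpha> \<beta> \<gamma> (v t) (\<lambda>p. \<phi> (t, p)) = ?J t" for t
    proof -
      let ?w = "aff 1 (c * (t - t0), 0)" and ?w' = "aff 1 (- (c * (t - t0)), 0)"
      have ww: "?w (?w' p) = p" for p by (cases p) (simp add: zero_prod_def)
      have tb: "test_function UNIV (\<lambda>p. Dt \<phi> (t, ?w p))"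
        by (rule test_function_aff[OF one test_function_slice[OF test_function_dir_deriv[OF \<phi>U]]])
      have ta: "test_function UNIV (\<lambda>p. \<phi> (t, ?w p))"
        by (rule test_function_aff[OF one test_function_slice[OF \<phi>U]])
      have m: "mass_form (v t) (\<lambda>p. Dt \<phi> (t, p)) = mass_form f (\<lambda>p. Dt \<phi> (t, ?w p))"
        using mass_form_aff[OF one f tb, of "(- (c * (t - t0)), 0)"] unfolding v_def ww by simp
      have "flux_form \<alpha> \<beta> \<gamma> (v t) (\<lambda>p. \<phi> (t, p)) = flux_form \<alpha> \<beta> \<gamma> f (\<lambda>p. \<phi> (t, ?w p))"
        using flux_form_aff[OF one f ta, of \<alpha> \<beta> \<gamma> "(- (c * (t - t0)), 0)"] unfolding v_def ww by simp
      also have "\<dots> = c * mass_form f (dx (\<lambda>p. \<phi> (t, ?w p)))" by (rule bal[OF ta])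
      finally have fl: "flux_form \<alpha> \<beta> \<gamma> (v t) (\<lambda>p. \<phi> (t, p)) = c * mass_form f (dx (\<lambda>p. \<phi> (t, ?w p)))" .
      note tc = test_function_dir_deriv[OF ta, of "(1, 0)"]
      note sD = smooth_dir_deriv[OF s\<phi>]
      have Lb: "Lx (\<lambda>p. Dt \<phi> (t, ?w p)) p = Dt (L_op \<phi>) (t, ?w p)" for p
      proof -
        have c: "Dx (Dt h) = Dt (Dx h)" if "smooth h" for h
          by (rule ext) (rule dir_deriv_commute[OF that])
        have "Lx (\<lambda>p. Dt \<phi> (t, ?w p)) p = L_op (Dt \<phi>) (t, ?w p)"
          using Lx_aff[OF one test_function_smooth[OF test_function_slice[OF test_function_dir_deriv[OF \<phi>U]]], of "(1, 0, 0)" t "(c * (t - t0), 0)" p]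
            slice_L_op[OF sD, of "(1, 0, 0)" t "?w p"] by simp
        also have "L_op (Dt \<phi>) = Dt (L_op \<phi>)"
        proof -
          have "(\<lambda>p. Dt \<phi> p - Dx (Dx (Dt \<phi>)) p) = Dt (\<lambda>p. \<phi> p - Dx (Dx \<phi>) p)"
            using s\<phi> by (auto simp: c smooth_dir_deriv dir_deriv_diff smooth_differentiable)
          then show ?thesis unfolding L_op_def by (simp add: c smooth_diff smooth_dir_deriv s\<phi>)
        qed
        finally show ?thesis .
      qed
      have La: "Lx (dx (\<lambda>p. \<phi> (t, ?w p))) p = Dx (L_op \<phi>) (t, ?w p)" for p
      proof -
        have "dx (\<lambda>p. \<phi> (t, ?w p)) = (\<lambda>p. Dx \<phi> (t, ?w p))"
          using dir_deriv_aff(1)[OF test_function_smooth[OF test_function_slice[OF \<phi>U]], of t 1 "(c * (t - t0), 0)"]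
          by (simp add: fun_eq_iff slice_dir_deriv_apply s\<phi>)
        then have "Lx (dx (\<lambda>p. \<phi> (t, ?w p))) p = L_op (Dx \<phi>) (t, ?w p)"
          using Lx_aff[OF one test_function_smooth[OF test_function_slice[OF test_function_dir_deriv[OF \<phi>U]]], of "(0, 1, 0)" t "(c * (t - t0), 0)" p]
            slice_L_op[OF sD, of "(0, 1, 0)" t "?w p"] by simp
        also have "L_op (Dx \<phi>) = Dx (L_op \<phi>)"
        proof -
          have "(\<lambda>p. Dx \<phi> p - Dx (Dx (Dx \<phi>)) p) = Dx (\<lambda>p. \<phi> p - Dx (Dx \<phi>) p)"
            using s\<phi> by (auto simp: smooth_dir_deriv dir_deriv_diff smooth_differentiable)
          then show ?thesis unfolding L_op_def by simp
        qed
        finally show ?thesis .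
      qed
      have d: "Dt \<Phi> (t, p) = Dt (L_op \<phi>) (t, ?w p) + c * Dx (L_op \<phi>) (t, ?w p)" for p
      proof -
        have "Dt \<Phi> (t, p) = dir_deriv (A (1, 0, 0)) (L_op \<phi>) (A (t, p) + b)"
          unfolding \<Phi>_def[abs_def]
          by (rule dir_deriv_affine[OF A[unfolded linear_conv_bounded_linear] smooth_differentiable[OF sL]])
        also have "A (1, 0, 0) = 1 *\<^sub>R (1, 0, 0) + c *\<^sub>R (0, 1, 0)" by (simp add: A_def)
        finally show ?thesis unfolding Ab smooth_dir_deriv_comb[OF sL] by simp
      qed
      have "integrable lebesgue (\<lambda>p. f p * Lx (\<lambda>p. Dt \<phi> (t, ?w p)) p)"
        "integrable lebesgue (\<lambda>p. f p * Lx (dx (\<lambda>p. \<phi> (t, ?w p))) p)"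
        by (intro integrable_mult_L2 H1_L2[OF f] L2_test_function[OF test_function_Lx[OF tb]]
            L2_test_function[OF test_function_Lx[OF tc]])+
      then show ?thesis
        unfolding m fl unfolding mass_form_def d Lb La
        by (simp add: distrib_left mult.left_commute[of _ c])
    qed
    have cJ: "continuous_on {0..T} ?J"
      by (intro continuous_at_imp_continuous_on ballI DERIV_isCont[OF D[OF test_function_dir_deriv[OF t\<Phi>]]])
    have "(?J has_integral ((LINT p|lebesgue. f p * \<Phi> (T, p)) - (LINT p|lebesgue. f p * \<Phi> (0, p)))) {0..T}"
      by (rule fundamental_theorem_of_calculus)
         (use T in \<open>auto intro!: has_field_derivative_at_within[OF D[OF t\<Phi>]] simp flip: has_real_derivative_iff_has_vector_derivative\<close>)
    moreover have "\<Phi> (s, p) = 0" if "s \<notin> {0<..<T}" for s p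
    proof -
      obtain K where "K \<subseteq> {0<..<T} \<times> UNIV" "\<And>q. q \<notin> K \<Longrightarrow> L_op \<phi> q = 0"
        using tL unfolding test_function_iff by blast
      then show ?thesis unfolding \<Phi>_def Ab using that by blast
    qed
    ultimately have "integral {0..T} ?J = 0" by (simp add: integral_unique)
    then have "(LINT t:{0..T}|lebesgue. ?J t) = 0"
      using set_lebesgue_integral_eq_integral(2)[OF absolutely_integrable_continuous_real[OF cJ]] by simp
    then show ?thesis
      unfolding weak_form_slice[OF Hv \<phi>U] inner .
  qed
  then show ?thesis using cv unfolding weak_solution_def v_def by blast
qed

section \<open>Symmetric solutions are traveling waves\<close>

theorem theorem4:
  fixes \<alpha> \<beta> \<gamma> T t0 :: real and u :: "real \<Rightarrow> real \<times> real \<Rightarrow> real"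
  assumes "T > 0"
    and "\<alpha> \<ge> 0" and "\<beta> \<ge> 0" and "\<gamma> \<ge> 0"
    and "t0 \<in> {0..T}"
    and "weak_solution \<alpha> \<beta> \<gamma> T u"
    and "only_weak_solution \<alpha> \<beta> \<gamma> T t0 u"
    and "x_symmetric {0..T} u"
  shows "x_traveling_wave {0..T} u"
proof -
  from assms(8) obtain l where l: "l C1_differentiable_on UNIV"
    and sym: "\<And>t. t \<in> {0..T} \<Longrightarrow> AE (x, y) in lebesgue. u t (x, y) = u t (2 * l t - x, y)"
    unfolding x_symmetric_def by blast
  from l obtain l' where l': "\<And>t. (l has_vector_derivative l' t) (at t)" "continuous_on UNIV l'"
    unfolding C1_differentiable_on_def by blast
  have sym': "AE p in lebesgue. u t p = u t (aff (-1) (2 * l t, 0) p)" if "t \<in> {0..T}" for t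
    using sym[OF that] by (simp add: aff_def split_beta)
  \<comment> \<open>The wave moves with the velocity of the axis of symmetry at the time at which uniqueness is known.\<close>
  define c where "c = l' t0"
  have H: "H1 (u t0)"
    using assms(5,6) by (simp add: weak_solution_def continuous_H1_def)
  define v where "v t p = u t0 (aff 1 (- (c * (t - t0)), 0) p)" for t p
  have "weak_solution \<alpha> \<beta> \<gamma> T v"
    unfolding v_def[abs_def]
  proof (rule weak_solution_traveling[OF assms(1) H])
    show "flux_form \<alpha> \<beta> \<gamma> (u t0) \<psi> = c * mass_form (u t0) (dx \<psi>)" if "test_function UNIV \<psi>" for \<psi>
      unfolding c_def
      by (rule symmetric_flux_form[OF assms(1,6) that _ l'(2) assms(5) sym'])
         (simp_all add: l'(1) has_real_derivative_iff_has_vector_derivative)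
  qed
  moreover have "v t0 = u t0" by (simp add: v_def fun_eq_iff zero_prod_def[symmetric])
  ultimately have eq: "AE p in lebesgue. v t p = u t p" if "t \<in> {0..T}" for t
    using assms(7) that by (auto simp: only_weak_solution_def)
  show ?thesis
    unfolding x_traveling_wave_def
  proof (intro exI ballI)
    fix t assume "t \<in> {0..T}"
    from eq[OF this]
    show "AE (x, y) in lebesgue. u t (x, y) = (\<lambda>(x, y). u t0 (x + c * t0, y)) (x - c * t, y)"
      by eventually_elim (auto simp: v_def algebra_simps)
  qed
qed

end
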